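(* Let $B\subseteq\mathbb{R}$ be an open interval with metric $g_B=\varepsilon\,dr^2$, where $\varepsilon\in\{+1,-1\}$, and let $(F_k,g_F)$, $k\ge1$, be a pseudo-Riemannian Einstein manifold with constant $\nu$. Let $\mu\in\mathbb{R}\setminus\{0,1,k,\overline{\mu}_+,\overline{\mu}_-\}$, where $\overline{\mu}_\pm=k\mp\sqrt{k^2-k}$, let $\psi\in C^\infty_{>0}(B)$, put $v=\psi^{1-\mu}$, and let $M=B\times F$ with the metric $\psi^{2\mu}g_B+\psi^2g_F$. (a) Suppose $k\ge2$, and consider the ordinary differential equation $$(k-1)\left(\frac{\varepsilon}{(1-\mu)^2}(v')^2+\frac{\lambda}{k}v^{\frac{2}{1-\mu}}\right)=\nu.\qquad(\ast)$$ If $M$ is Einstein with $\lambda$, then $\lambda$ is constant and $v$ satisfies $(\ast)$. If, for a constant $\lambda\in\mathbb{R}$, $v$ is a nonconstant solution of $(\ast)$ on $B$, then $M$ is Einstein with $\lambda$. If $\psi$ is constant, then $M$ is Einstein with $\lambda$ if and only if $\lambda=0=\nu$. (b) Suppose $k=1$ (so $\nu=0$) and let $\lambda\in C^\infty(B)$. Then $M$ is Einstein with $\lambda$ if and only if $$\lambda\, v^{\frac{2\mu}{1-\mu}}=\frac{\varepsilon}{\mu-1}\,\frac{v''}{v}\quad\text{on }B.$$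
   Context: A pseudo-Riemannian manifold $(N,h)$ is called Einstein with $\lambda\in C^\infty(N)$ if $\mathrm{Ric}_h=\lambda h$ ($\mathrm{Ric}$ with the sign convention making round spheres have positive Ricci curvature). $C^\infty_{>0}(B)$ is the set of smooth positive functions on $B$; functions and metrics on the factors are identified with their pullbacks to $B\times F$. Primes denote derivatives with respect to the coordinate $r$ on $B$. Manifolds are connected. *)

theory Defs
  imports "HOL-Analysis.Analysis"
begin

section \<open>Smooth maps between Euclidean spaces\<close>

text \<open>Intended for open \<open>S\<close>: there \<open>Ck_on n S f\<close> says that \<open>f\<close> is of class \<open>C\<close>-\<open>n\<close> on \<open>S\<close>.\<close>

fun Ck_on :: "nat \<Rightarrow> 'e::euclidean_space set \<Rightarrow> ('e \<Rightarrow> 'b::real_normed_vector) \<Rightarrow> bool" where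
  "Ck_on 0 S f \<longleftrightarrow> continuous_on S f"
| "Ck_on (Suc n) S f \<longleftrightarrow> f differentiable_on S \<and>
     (\<forall>b\<in>Basis. Ck_on n S (\<lambda>x. frechet_derivative f (at x) b))"

definition smooth_on :: "'e::euclidean_space set \<Rightarrow> ('e \<Rightarrow> 'b::real_normed_vector) \<Rightarrow> bool" where
  "smooth_on S f \<longleftrightarrow> (\<forall>n. Ck_on n S f)"

section \<open>Manifolds\<close>

text \<open>A manifold modelled on the Euclidean space \<open>'e\<close> is given by an indexed family of charts
  \<open>chart A i : dom A i \<rightarrow> 'e\<close>, \<open>i \<in> index A\<close>; its dimension is \<open>DIM('e)\<close>, and its
  underlying space is the union of the chart domains, which may be a proper open subset of the
  type \<open>'a\<close>.\<close>

record ('i, 'a, 'e) atlas =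
  index :: "'i set"
  dom :: "'i \<Rightarrow> 'a set"
  chart :: "'i \<Rightarrow> 'a \<Rightarrow> 'e"

definition carrier :: "('i, 'a, 'e) atlas \<Rightarrow> 'a set" where
  "carrier A = (\<Union>i\<in>index A. dom A i)"

definition coords :: "('i, 'a, 'e) atlas \<Rightarrow> 'i \<Rightarrow> 'e set" where
  "coords A i = chart A i ` dom A i"

definition param :: "('i, 'a, 'e) atlas \<Rightarrow> 'i \<Rightarrow> 'e \<Rightarrow> 'a" where
  "param A i = inv_into (dom A i) (chart A i)"

definition transition :: "('i, 'a, 'e) atlas \<Rightarrow> 'i \<Rightarrow> 'i \<Rightarrow> 'e \<Rightarrow> 'e" where
  "transition A i j = chart A j \<circ> param A i"

definition connected_manifold ::
  "('i, 'a::{second_countable_topology, t2_space}, 'e::euclidean_space) atlas \<Rightarrow> bool" where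
  "connected_manifold A \<longleftrightarrow>
     (\<forall>i\<in>index A. open (dom A i) \<and> open (coords A i) \<and>
        homeomorphism (dom A i) (coords A i) (chart A i) (param A i)) \<and>
     (\<forall>i\<in>index A. \<forall>j\<in>index A.
        smooth_on (chart A i ` (dom A i \<inter> dom A j)) (transition A i j)) \<and>
     connected (carrier A) \<and> carrier A \<noteq> {}"

definition smooth_function ::
  "('i, 'a, 'e::euclidean_space) atlas \<Rightarrow> ('a \<Rightarrow> real) \<Rightarrow> bool" where
  "smooth_function A f \<longleftrightarrow> (\<forall>i\<in>index A. smooth_on (coords A i) (f \<circ> param A i))"

section \<open>Pseudo-Riemannian metrics\<close>

text \<open>A metric is given by its coordinate representations: \<open>g i x u w\<close> is the value, at the point
  with coordinates \<open>x\<close> in chart \<open>i\<close>, on the tangent vectors whose components in that chart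
  are \<open>u\<close> and \<open>w\<close>. The last condition is the transformation law of (0,2)-tensors.\<close>

type_synonym ('i, 'e) metric_field = "'i \<Rightarrow> 'e \<Rightarrow> 'e \<Rightarrow> 'e \<Rightarrow> real"

definition pseudo_riemannian_metric ::
  "('i, 'a, 'e::euclidean_space) atlas \<Rightarrow> ('i, 'e) metric_field \<Rightarrow> bool" where
  "pseudo_riemannian_metric A g \<longleftrightarrow>
     (\<forall>i\<in>index A. \<forall>x\<in>coords A i.
        bilinear (g i x) \<and>
        (\<forall>u w. g i x u w = g i x w u) \<and>
        (\<forall>u. (\<forall>w. g i x u w = 0) \<longrightarrow> u = 0)) \<and>
     (\<forall>i\<in>index A. \<forall>u w. smooth_on (coords A i) (\<lambda>x. g i x u w)) \<and>
     (\<forall>i\<in>index A. \<forall>j\<in>index A. \<forall>x\<in>chart A i ` (dom A i \<inter> dom A j). \<forall>u w.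
        g i x u w =
        g j (transition A i j x) (frechet_derivative (transition A i j) (at x) u)
                                 (frechet_derivative (transition A i j) (at x) w))"

section \<open>Ricci curvature and Einstein manifolds\<close>

text \<open>In the following, \<open>g\<close> is the coordinate representation of a metric in one fixed chart, and
  elements of \<open>'e\<close> stand for vector fields with constant components, which commute.
  \<open>christoffel g x u w\<close> is the Levi-Civita derivative of \<open>w\<close> in direction \<open>u\<close> at \<open>x\<close>, given by the
  Koszul formula; for \<open>u\<close>, \<open>w\<close> basis vectors its components are the Christoffel symbols.
  It is well defined because \<open>g x\<close> is nondegenerate.\<close>

definition dir_deriv :: "('e::euclidean_space \<Rightarrow> 'b::real_normed_vector) \<Rightarrow> 'e \<Rightarrow> 'e \<Rightarrow> 'b" where
  "dir_deriv f x u = frechet_derivative f (at x) u"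

definition christoffel ::
  "('e::euclidean_space \<Rightarrow> 'e \<Rightarrow> 'e \<Rightarrow> real) \<Rightarrow> 'e \<Rightarrow> 'e \<Rightarrow> 'e \<Rightarrow> 'e" where
  "christoffel g x u w = (THE z. \<forall>t. 2 * g x z t =
       dir_deriv (\<lambda>y. g y w t) x u + dir_deriv (\<lambda>y. g y u t) x w - dir_deriv (\<lambda>y. g y u w) x t)"

definition curvature ::
  "('e::euclidean_space \<Rightarrow> 'e \<Rightarrow> 'e \<Rightarrow> real) \<Rightarrow> 'e \<Rightarrow> 'e \<Rightarrow> 'e \<Rightarrow> 'e \<Rightarrow> 'e" where
  "curvature g x u w t =
     dir_deriv (\<lambda>y. christoffel g y w t) x u - dir_deriv (\<lambda>y. christoffel g y u t) x w
     + christoffel g x u (christoffel g x w t) - christoffel g x w (christoffel g x u t)"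

text \<open>The trace of \<open>u \<mapsto> R(u, w) t\<close>; with this sign round spheres have positive Ricci curvature.\<close>

definition ricci ::
  "('e::euclidean_space \<Rightarrow> 'e \<Rightarrow> 'e \<Rightarrow> real) \<Rightarrow> 'e \<Rightarrow> 'e \<Rightarrow> 'e \<Rightarrow> real" where
  "ricci g x w t = (\<Sum>b\<in>Basis. curvature g x b w t \<bullet> b)"

definition einstein_with ::
  "('i, 'a::{second_countable_topology, t2_space}, 'e::euclidean_space) atlas
     \<Rightarrow> ('i, 'e) metric_field \<Rightarrow> ('a \<Rightarrow> real) \<Rightarrow> bool" where
  "einstein_with A g lam \<longleftrightarrow>
     connected_manifold A \<and> pseudo_riemannian_metric A g \<and> smooth_function A lam \<and>
     (\<forall>i\<in>index A. \<forall>x\<in>coords A i. \<forall>u w. ricci (g i) x u w = lam (param A i x) * g i x u w)"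

section \<open>Intervals, products and pullbacks\<close>

definition interval_atlas :: "real set \<Rightarrow> (unit, real, real) atlas" where
  "interval_atlas B = \<lparr>index = UNIV, dom = (\<lambda>_. B), chart = (\<lambda>_ r. r)\<rparr>"

text \<open>The metric \<open>\<epsilon> dr\<^sup>2\<close>.\<close>

definition interval_metric :: "real \<Rightarrow> (unit, real) metric_field" where
  "interval_metric \<epsilon> = (\<lambda>_ _ a b. \<epsilon> * a * b)"

definition product_atlas ::
  "('i, 'a, 'd) atlas \<Rightarrow> ('j, 'b, 'e) atlas \<Rightarrow> ('i \<times> 'j, 'a \<times> 'b, 'd \<times> 'e) atlas" where
  "product_atlas A A' = \<lparr>index = index A \<times> index A',
     dom = (\<lambda>(i, j). dom A i \<times> dom A' j),
     chart = (\<lambda>(i, j) (p, q). (chart A i p, chart A' j q))\<rparr>"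

text \<open>The tensor field \<open>f g + f' g'\<close> on the product, where \<open>f\<close>, \<open>f'\<close> are functions on the product
  and \<open>g\<close>, \<open>g'\<close> (metrics on the factors) are identified with their pullbacks.\<close>

definition weighted_product_metric ::
  "('i, 'a, 'd) atlas \<Rightarrow> ('j, 'b, 'e) atlas \<Rightarrow> ('a \<times> 'b \<Rightarrow> real) \<Rightarrow> ('i, 'd) metric_field
     \<Rightarrow> ('a \<times> 'b \<Rightarrow> real) \<Rightarrow> ('j, 'e) metric_field \<Rightarrow> ('i \<times> 'j, 'd \<times> 'e) metric_field" where
  "weighted_product_metric A A' f g f' g' = (\<lambda>(i, j) (x, y) (u, u') (w, w').
     f (param A i x, param A' j y) * g i x u w + f' (param A i x, param A' j y) * g' j y u' w')"

end

theory Submission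
  imports Defs
begin

text \<open>Writing \<open>X = \<epsilon> \<psi>\<^sup>-\<^sup>2\<^sup>\<mu> \<psi>'\<^sup>2\<close> and \<open>Y = \<epsilon> \<psi>\<^sup>-\<^sup>2\<^sup>\<mu> \<psi> \<psi>''\<close>, the warped product formula for the
  Ricci tensor makes the Einstein condition equivalent to the two equations
  \<open>\<lambda> \<psi>\<^sup>2 = k (\<mu> X - Y)\<close> and \<open>\<lambda> \<psi>\<^sup>2 = \<nu> - (k - 1 - \<mu>) X - Y\<close>. For \<open>k = 1\<close> they coincide, since \<open>\<nu> = 0\<close>.
  For \<open>k \<ge> 2\<close>, eliminating \<open>Y\<close> gives the first integral \<open>(k - 1) (X + \<lambda> \<psi>\<^sup>2 / k) = \<nu>\<close>, which is the
  equation for \<open>v\<close>; its derivative is \<open>\<psi>'\<close> times the first equation when \<open>\<lambda>\<close> is constant, and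
  \<open>\<lambda>' = 0\<close> when the first equation holds.\<close>

subsection \<open>Smooth functions on open sets\<close>

text \<open>The coordinate r is kept on the base instead of passing to arc length; the base
  coefficient then has its own Christoffel symbol \<mu> \<psi>'/\<psi>, and \<mu> enters the
  curvature through it. The Ricci tensor of the product has no mixed part, and its fibre part is a
  multiple of the fibre metric because F is Einstein; comparing the two blocks with the metric
  produces exactly two scalar equations. The delicate direction is the return from the first
  integral. Differentiation yields only \<psi>' times the wanted equation, and \<psi>' may have
  zeros that cannot be divided out, so connectedness of B has to exclude a mixture of regions where
  \<psi> is constant and regions where the equation holds. In the forward direction, constancy of
  \<lambda> along B is read off from the first integral solved for \<lambda>, and independence of
  the fibre point from the equation itself. Since \<open>christoffel\<close> is a definite
  description and \<open>curvature\<close> differentiates it, the tensor calculation rests on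
  existence and differentiability of the fibre's Christoffel symbols.\<close>

lemma frechet_derivative_cong_open:
  assumes "open S" "x \<in> S" "\<And>y. y \<in> S \<Longrightarrow> f y = h y"
  shows "frechet_derivative f (at x) = frechet_derivative h (at x)"
proof -
  have "(f has_derivative D) (at x) \<longleftrightarrow> (h has_derivative D) (at x)" for D
    using assms has_derivative_transform_within_open by metis
  then show ?thesis by (simp add: frechet_derivative_def)
qed

lemma Ck_on_cong:
  assumes "open S" "\<And>x. x \<in> S \<Longrightarrow> f x = h x"
  shows "Ck_on n S f \<longleftrightarrow> Ck_on n S h"
  using assms(2)
proof (induction n arbitrary: f h)
  case 0
  then show ?case by (simp cong: continuous_on_cong)
next
  case (Suc n)
  have "f differentiable_on S \<longleftrightarrow> h differentiable_on S"
    using Suc.prems by (metis differentiable_on_def differentiable_transform_within zero_less_one)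
  moreover have "Ck_on n S (\<lambda>x. frechet_derivative f (at x) b)
      \<longleftrightarrow> Ck_on n S (\<lambda>x. frechet_derivative h (at x) b)" for b
    using frechet_derivative_cong_open[OF assms(1) _ Suc.prems] by (intro Suc.IH) auto
  ultimately show ?case by simp
qed

text \<open>Trades \<open>frechet_derivative\<close> for any derivative \<open>D\<close>, so that
  the inductions on \<open>n\<close> below can take their derivative formulas from the library's
  differentiation rules.\<close>

lemma Ck_on_SucI:
  assumes "open S" "\<And>x. x \<in> S \<Longrightarrow> (f has_derivative D x) (at x)"
    and "\<And>b. b \<in> Basis \<Longrightarrow> Ck_on n S (\<lambda>x. D x b)"
  shows "Ck_on (Suc n) S f"
proof -
  have "frechet_derivative f (at x) = D x" if "x \<in> S" for x
    using frechet_derivative_at[OF assms(2)[OF that]] by simp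
  then have "Ck_on n S (\<lambda>x. frechet_derivative f (at x) b)" if "b \<in> Basis" for b
    using that by (subst Ck_on_cong[OF assms(1), of _ "\<lambda>x. D x b"]) (auto simp: assms(3))
  moreover have "f differentiable_on S"
    using assms(2) by (meson differentiableI differentiable_at_imp_differentiable_on)
  ultimately show ?thesis by simp
qed

lemma Ck_on_SucD:
  assumes "open S" "Ck_on (Suc n) S f"
  shows "x \<in> S \<Longrightarrow> (f has_derivative frechet_derivative f (at x)) (at x)"
    and "b \<in> Basis \<Longrightarrow> Ck_on n S (\<lambda>x. frechet_derivative f (at x) b)"
  using assms by (auto simp: differentiable_on_eq_differentiable_at frechet_derivative_works[symmetric])

text \<open>In the product and chain rules one factor stays undifferentiated and must be available
  at the order of the induction hypothesis.\<close>

lemma Ck_on_SucD_lower: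
  assumes "Ck_on (Suc n) S f"
  shows "Ck_on n S f"
  using assms
proof (induction n arbitrary: f)
  case 0
  then show ?case by (simp add: differentiable_imp_continuous_on)
next
  case (Suc n)
  show ?case
    using Suc.prems Suc.IH unfolding Ck_on.simps(2)[of n] Ck_on.simps(2)[of "Suc n"] by blast
qed

lemma Ck_on_const: "Ck_on n S (\<lambda>_. c)"
proof (induction n arbitrary: c)
  case (Suc n)
  have "frechet_derivative (\<lambda>_. c) (at x) = (\<lambda>_. 0)" for x
    using frechet_derivative_at[OF has_derivative_const, of c] by auto
  then show ?case using Suc by simp
qed simp

lemma Ck_on_bounded_linear:
  assumes "open S" "bounded_linear L"
  shows "Ck_on n S L"
proof (cases n)
  case 0
  then show ?thesis using assms(2) by (simp add: linear_continuous_on)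
next
  case (Suc m)
  then show ?thesis
    using Ck_on_SucI[OF assms(1), of L "\<lambda>_. L"] assms(2) Ck_on_const
      bounded_linear.has_derivative[OF assms(2) has_derivative_ident] by blast
qed

lemma Ck_on_compose_bounded_linear:
  assumes "open S" "bounded_linear L" "Ck_on n S f"
  shows "Ck_on n S (\<lambda>x. L (f x))"
  using assms(3)
proof (induction n arbitrary: f)
  case 0
  then show ?case using assms(2) by (simp add: bounded_linear.continuous_on)
next
  case (Suc n)
  note f = Ck_on_SucD[OF assms(1) Suc.prems]
  show ?case
    by (rule Ck_on_SucI[OF assms(1) bounded_linear.has_derivative[OF assms(2) f(1)] Suc.IH[OF f(2)]])
qed

lemma Ck_on_add:
  assumes "open S" "Ck_on n S f" "Ck_on n S h"
  shows "Ck_on n S (\<lambda>x. f x + h x)"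
  using assms(2,3)
proof (induction n arbitrary: f h)
  case 0
  then show ?case by (simp add: continuous_on_add)
next
  case (Suc n)
  note f = Ck_on_SucD[OF assms(1) Suc.prems(1)] and h = Ck_on_SucD[OF assms(1) Suc.prems(2)]
  show ?case
    by (rule Ck_on_SucI[OF assms(1) has_derivative_add[OF f(1) h(1)] Suc.IH[OF f(2) h(2)]])
qed

lemma Ck_on_sum:
  assumes "open S" "\<And>i. i \<in> I \<Longrightarrow> Ck_on n S (f i)"
  shows "Ck_on n S (\<lambda>x. \<Sum>i\<in>I. f i x)"
  using assms(2) by (induction I rule: infinite_finite_induct)
    (auto simp: Ck_on_const intro!: Ck_on_add assms(1))

lemma Ck_on_scaleR:
  assumes "open S" "Ck_on n S f" "Ck_on n S h"
  shows "Ck_on n S (\<lambda>x. f x *\<^sub>R h x)"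
  using assms(2,3)
proof (induction n arbitrary: f h)
  case 0
  then show ?case by (simp add: continuous_on_scaleR)
next
  case (Suc n)
  note f = Ck_on_SucD[OF assms(1) Suc.prems(1)] and h = Ck_on_SucD[OF assms(1) Suc.prems(2)]
  show ?case
    by (rule Ck_on_SucI[OF assms(1) has_derivative_scaleR[OF f(1) h(1)]])
      (auto intro!: Ck_on_add[OF assms(1)] Suc.IH f h Suc.prems[THEN Ck_on_SucD_lower])
qed

text \<open>By the chain rule, partial derivatives of the composite are built from those of
  \<open>f\<close> and from partial derivatives of \<open>h\<close> composed with \<open>f\<close>;
  the latter are covered by the induction hypothesis because \<open>h\<close> is arbitrary in
  it.\<close>

lemma Ck_on_compose:
  fixes f :: "'d::euclidean_space \<Rightarrow> 'e::euclidean_space"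
  assumes "open S" "open T" "f ` S \<subseteq> T" "Ck_on n S f" "Ck_on n T h"
  shows "Ck_on n S (\<lambda>x. h (f x))"
  using assms(4,5)
proof (induction n arbitrary: h)
  case 0
  then show ?case using assms(3) by (auto intro: continuous_on_compose2)
next
  case (Suc n)
  note f = Ck_on_SucD[OF assms(1) Suc.prems(1)] and h = Ck_on_SucD[OF assms(2) Suc.prems(2)]
  let ?D = "\<lambda>x b. frechet_derivative h (at (f x)) (frechet_derivative f (at x) b)"
  have D: "((\<lambda>x. h (f x)) has_derivative ?D x) (at x)" if "x \<in> S" for x
    using has_derivative_compose[OF f(1)[OF that] h(1)] that assms(3) by blast
  \<comment> \<open>\<open>Ck_on\<close> controls derivatives along basis vectors only, while the
    chain rule evaluates the derivative of \<open>h\<close> at a varying vector. Expanding that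
    vector turns its components into scalar coefficient functions.\<close>
  have D_sum: "?D x b = (\<Sum>c\<in>Basis. (frechet_derivative f (at x) b \<bullet> c) *\<^sub>R
      frechet_derivative h (at (f x)) c)" if "x \<in> S" for x b
  proof -
    have "bounded_linear (frechet_derivative h (at (f x)))"
      using h(1) that assms(3) has_derivative_bounded_linear by blast
    then interpret bounded_linear "frechet_derivative h (at (f x))" .
    show ?thesis
      by (subst euclidean_representation[of "frechet_derivative f (at x) b", symmetric])
        (simp add: sum scaleR)
  qed
  have "Ck_on n S (\<lambda>x. ?D x b)" if "b \<in> Basis" for b
  proof -
    have "Ck_on n S (\<lambda>x. \<Sum>c\<in>Basis. (frechet_derivative f (at x) b \<bullet> c) *\<^sub>R
        frechet_derivative h (at (f x)) c)"
      using f(2)[OF that] h(2) Suc.prems[THEN Ck_on_SucD_lower]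
      by (intro Ck_on_sum Ck_on_scaleR assms(1) Suc.IH
          Ck_on_compose_bounded_linear[OF _ bounded_linear_inner_left]) auto
    then show ?thesis
      by (rule iffD2[OF Ck_on_cong[OF assms(1)], rotated]) (rule D_sum)
  qed
  with D show ?case by (intro Ck_on_SucI[OF assms(1)])
qed

section \<open>Closure properties of smooth maps\<close>

lemma smooth_on_cong:
  "open S \<Longrightarrow> (\<And>x. x \<in> S \<Longrightarrow> f x = h x) \<Longrightarrow> smooth_on S f \<longleftrightarrow> smooth_on S h"
  unfolding smooth_on_def using Ck_on_cong by blast

lemma smooth_on_const: "smooth_on S (\<lambda>_. c)"
  by (simp add: smooth_on_def Ck_on_const)

lemma smooth_on_bounded_linear: "open S \<Longrightarrow> bounded_linear L \<Longrightarrow> smooth_on S L"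
  by (simp add: smooth_on_def Ck_on_bounded_linear)

lemma smooth_on_compose_bounded_linear:
  "open S \<Longrightarrow> bounded_linear L \<Longrightarrow> smooth_on S f \<Longrightarrow> smooth_on S (\<lambda>x. L (f x))"
  by (simp add: smooth_on_def Ck_on_compose_bounded_linear)

lemma smooth_on_add:
  "open S \<Longrightarrow> smooth_on S f \<Longrightarrow> smooth_on S h \<Longrightarrow> smooth_on S (\<lambda>x. f x + h x)"
  by (simp add: smooth_on_def Ck_on_add)

lemma smooth_on_mult:
  fixes f h :: "'e::euclidean_space \<Rightarrow> real"
  shows "open S \<Longrightarrow> smooth_on S f \<Longrightarrow> smooth_on S h \<Longrightarrow> smooth_on S (\<lambda>x. f x * h x)"
  using Ck_on_scaleR[of S _ f h] by (simp add: smooth_on_def)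

lemma smooth_on_compose:
  fixes f :: "'d::euclidean_space \<Rightarrow> 'e::euclidean_space"
  shows "open S \<Longrightarrow> open T \<Longrightarrow> f ` S \<subseteq> T \<Longrightarrow> smooth_on S f \<Longrightarrow> smooth_on T h
    \<Longrightarrow> smooth_on S (\<lambda>x. h (f x))"
  by (simp add: smooth_on_def Ck_on_compose)

lemma smooth_on_fst:
  fixes f :: "'d::euclidean_space \<Rightarrow> 'b::real_normed_vector"
  assumes "open S" "open T" "smooth_on S f"
  shows "smooth_on (S \<times> T) (\<lambda>z::'d \<times> 'e::euclidean_space. f (fst z))"
  by (rule smooth_on_compose[OF open_Times[OF assms(1,2)] assms(1) _
        smooth_on_bounded_linear[OF open_Times[OF assms(1,2)] bounded_linear_fst] assms(3)]) auto

lemma smooth_on_snd: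
  fixes f :: "'e::euclidean_space \<Rightarrow> 'b::real_normed_vector"
  assumes "open S" "open T" "smooth_on T f"
  shows "smooth_on (S \<times> T) (\<lambda>z::'d::euclidean_space \<times> 'e. f (snd z))"
  by (rule smooth_on_compose[OF open_Times[OF assms(1,2)] assms(2) _
        smooth_on_bounded_linear[OF open_Times[OF assms(1,2)] bounded_linear_snd] assms(3)]) auto

lemma smooth_on_Pair:
  assumes "open S" "smooth_on S f" "smooth_on S h"
  shows "smooth_on S (\<lambda>x. (f x, h x))"
proof -
  have "smooth_on S (\<lambda>x. (f x, 0) + (0, h x))"
    using assms by (intro smooth_on_add
        smooth_on_compose_bounded_linear[where L = "\<lambda>a. (a, 0)"]
        smooth_on_compose_bounded_linear[where L = "\<lambda>a. (0, a)"])
      (auto intro: bounded_linear_Pair bounded_linear_ident bounded_linear_zero)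
  then show ?thesis by simp
qed

text \<open>The exponent is generalised in the induction because differentiation lowers it by
  one.\<close>

lemma Ck_on_powr: "Ck_on n {0<..} (\<lambda>x::real. x powr a)"
proof (induction n arbitrary: a)
  case 0
  then show ?case by (auto intro!: continuous_intros)
next
  case (Suc n)
  show ?case
  proof (rule Ck_on_SucI)
    show "((\<lambda>x. x powr a) has_derivative (\<lambda>t. (a * x powr (a - 1)) *\<^sub>R t)) (at x)"
      if "x \<in> {0<..}" for x :: real
      using has_real_derivative_powr[of x a] that by (simp add: has_field_derivative_def)
    show "Ck_on n {0<..} (\<lambda>x. (a * x powr (a - 1)) *\<^sub>R b)" for b
      using Ck_on_scaleR[OF _ Ck_on_scaleR[OF _ Ck_on_const[of n _ a] Suc.IH] Ck_on_const]
      by (simp add: open_greaterThan)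
  qed (simp add: open_greaterThan)
qed

lemma smooth_on_powr:
  fixes f :: "'e::euclidean_space \<Rightarrow> real"
  assumes "open S" "smooth_on S f" "\<And>x. x \<in> S \<Longrightarrow> f x > 0"
  shows "smooth_on S (\<lambda>x. f x powr a)"
  by (rule smooth_on_compose[OF assms(1) open_greaterThan _ assms(2), of 0])
    (use assms(3) in \<open>auto simp: smooth_on_def Ck_on_powr\<close>)

lemma smooth_onD:
  assumes "open S" "smooth_on S f"
  shows smooth_on_has_derivative:
      "x \<in> S \<Longrightarrow> (f has_derivative frechet_derivative f (at x)) (at x)"
    and smooth_on_dir_deriv: "smooth_on S (\<lambda>x. dir_deriv f x u)"
proof -
  show has: "(f has_derivative frechet_derivative f (at x)) (at x)" if "x \<in> S" for x
    using Ck_on_SucD(1)[OF assms(1) _ that, of 0 f] assms(2) unfolding smooth_on_def by blast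
  have b: "Ck_on n S (\<lambda>x. frechet_derivative f (at x) b)" if "b \<in> Basis" for n b
    using Ck_on_SucD(2)[OF assms(1) _ that, of n f] assms(2) unfolding smooth_on_def by blast
  have eq: "dir_deriv f x u = (\<Sum>b\<in>Basis. (u \<bullet> b) *\<^sub>R frechet_derivative f (at x) b)"
    if "x \<in> S" for x
  proof -
    interpret bounded_linear "frechet_derivative f (at x)"
      using has[OF that] by (rule has_derivative_bounded_linear)
    show ?thesis unfolding dir_deriv_def
      by (subst euclidean_representation[of u, symmetric]) (simp only: sum scaleR)
  qed
  show "smooth_on S (\<lambda>x. dir_deriv f x u)"
    by (rule iffD2[OF smooth_on_cong[OF assms(1) eq]], assumption)
      (use b in \<open>auto simp: smooth_on_def intro!: Ck_on_sum Ck_on_scaleR Ck_on_const assms(1)\<close>)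
qed

lemma dir_deriv_eqI:
  assumes "(h has_derivative D) (at x)" "open S" "x \<in> S" "\<And>y. y \<in> S \<Longrightarrow> f y = h y"
  shows "dir_deriv f x u = D u"
  using frechet_derivative_cong_open[OF assms(2-4)] frechet_derivative_at[OF assms(1)]
  by (simp add: dir_deriv_def)

text \<open>A linear map on the reals is multiplication by its value at 1. This links
  \<open>smooth_on\<close> to \<open>deriv\<close>, in which the equations for \<psi> and v are
  written.\<close>

lemma smooth_on_real:
  fixes f :: "real \<Rightarrow> real"
  assumes "open S" "smooth_on S f"
  shows smooth_on_has_real_derivative: "x \<in> S \<Longrightarrow> (f has_real_derivative deriv f x) (at x)"
    and smooth_on_deriv: "smooth_on S (deriv f)"
proof -
  have *: "(f has_real_derivative dir_deriv f x 1) (at x)" if "x \<in> S" for x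
  proof -
    have f: "(f has_derivative frechet_derivative f (at x)) (at x)"
      using smooth_on_has_derivative[OF assms that] .
    have "frechet_derivative f (at x) = (*) (dir_deriv f x 1)"
    proof
      fix t
      show "frechet_derivative f (at x) t = dir_deriv f x 1 * t"
        using linear_scale[OF has_derivative_linear[OF f], of t 1] by (simp add: dir_deriv_def)
    qed
    with f show ?thesis by (simp add: has_field_derivative_def)
  qed
  then have eq: "deriv f x = dir_deriv f x 1" if "x \<in> S" for x
    using that by (blast intro: DERIV_imp_deriv)
  show "x \<in> S \<Longrightarrow> (f has_real_derivative deriv f x) (at x)"
    using * eq by simp
  show "smooth_on S (deriv f)"
    using smooth_on_dir_deriv[OF assms, of 1] eq
      smooth_on_cong[OF assms(1), of "deriv f" "\<lambda>x. dir_deriv f x 1"] by blast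
qed

subsection \<open>The Levi-Civita connection in a chart\<close>

text \<open>The inverse function theorem, applied to \<open>(y, \<zeta>) \<mapsto> (y, L y \<zeta> - k y)\<close>, replaces Cramer's
  rule.\<close>

lemma linear_system_solution_differentiable:
  fixes L :: "'d::euclidean_space \<Rightarrow> 'e::euclidean_space \<Rightarrow> 'e"
  assumes U: "open U" "x \<in> U"
    and linear: "\<And>y. y \<in> U \<Longrightarrow> linear (L y)"
    and inj: "\<And>y z. y \<in> U \<Longrightarrow> L y z = 0 \<Longrightarrow> z = 0"
    and L: "\<And>y z. y \<in> U \<Longrightarrow> (\<lambda>y. L y z) differentiable (at y)"
    and k: "\<And>y. y \<in> U \<Longrightarrow> k differentiable (at y)"
    and sol: "\<And>y. y \<in> U \<Longrightarrow> L y (z y) = k y"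
  shows "z differentiable (at x)"
proof -
  have L_inj: "inj (L y)" if "y \<in> U" for y
    using linear[OF that] inj[OF that] linear_injective_0 by blast
  have L_inv: "L y (inv (L y) w) = w" if "y \<in> U" for y w
    using linear_inj_imp_surj[OF linear[OF that] L_inj[OF that]] by (rule surj_f_inv_f)
  have L_inv': "inv (L y) (L y w) = w" if "y \<in> U" for y w
    using L_inj[OF that] by (rule inv_f_f)
  have L_sum: "L y w = (\<Sum>b\<in>Basis. (w \<bullet> b) *\<^sub>R L y b)" if "y \<in> U" for y w
    by (subst euclidean_representation[of w, symmetric])
      (simp only: linear_sum[OF linear[OF that]] linear_scale[OF linear[OF that]])
  define \<Phi> where "\<Phi> = (\<lambda>p::'d \<times> 'e. (fst p, L (fst p) (snd p) - k (fst p)))"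
  define \<Psi> where "\<Psi> = (\<lambda>p::'d \<times> 'e. (fst p, inv (L (fst p)) (snd p + k (fst p))))"
  \<comment> \<open>\<open>N p\<close> is the derivative of
    \<open>\<lambda>y. L y (snd p) - k y\<close> at \<open>fst p\<close>. Hence
    \<open>\<Phi>' p\<close> is block triangular with diagonal blocks the identity and
    \<open>L (fst p)\<close>, and \<open>\<Psi>' p\<close> is its inverse.\<close>
  define N where "N = (\<lambda>(p::'d \<times> 'e) (h::'d). (\<Sum>b\<in>Basis. (snd p \<bullet> b) *\<^sub>R
      frechet_derivative (\<lambda>y. L y b) (at (fst p)) h) - frechet_derivative k (at (fst p)) h)"
  define \<Phi>' where "\<Phi>' = (\<lambda>p (h::'d \<times> 'e). (fst h, L (fst p) (snd h) + N p (fst h)))"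
  define \<Psi>' where "\<Psi>' = (\<lambda>p (h::'d \<times> 'e). (fst h, inv (L (fst p)) (snd h - N p (fst h))))"
  have \<Phi>_derivative: "(\<Phi> has_derivative \<Phi>' p) (at p)" if p: "p \<in> U \<times> UNIV" for p
  proof -
    have y: "fst p \<in> U" using p by auto
    have L': "((\<lambda>p. L (fst p) b) has_derivative
        (\<lambda>h. frechet_derivative (\<lambda>y. L y b) (at (fst p)) (fst h))) (at p)" for b
      by (rule has_derivative_compose[OF has_derivative_fst[OF has_derivative_ident]
            L[OF y, unfolded frechet_derivative_works]])
    have k': "((\<lambda>p. k (fst p)) has_derivative
        (\<lambda>h. frechet_derivative k (at (fst p)) (fst h))) (at p)"
      by (rule has_derivative_compose[OF has_derivative_fst[OF has_derivative_ident]
            k[OF y, unfolded frechet_derivative_works]])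
    have "((\<lambda>p. (fst p, (\<Sum>b\<in>Basis. (snd p \<bullet> b) *\<^sub>R L (fst p) b) - k (fst p)))
        has_derivative (\<lambda>h. (fst h, (\<Sum>b\<in>Basis. (snd p \<bullet> b) *\<^sub>R
          frechet_derivative (\<lambda>y. L y b) (at (fst p)) (fst h) + (snd h \<bullet> b) *\<^sub>R L (fst p) b)
          - frechet_derivative k (at (fst p)) (fst h)))) (at p)"
      by (intro has_derivative_Pair has_derivative_diff has_derivative_sum has_derivative_scaleR
          has_derivative_inner_left has_derivative_fst has_derivative_snd has_derivative_ident L' k')
    moreover have "(\<lambda>h. (fst h, (\<Sum>b\<in>Basis. (snd p \<bullet> b) *\<^sub>R
          frechet_derivative (\<lambda>y. L y b) (at (fst p)) (fst h) + (snd h \<bullet> b) *\<^sub>R L (fst p) b)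
          - frechet_derivative k (at (fst p)) (fst h))) = \<Phi>' p"
      by (simp add: \<Phi>'_def N_def sum.distrib L_sum[OF y, symmetric] fun_eq_iff algebra_simps)
    ultimately have "((\<lambda>p. (fst p, (\<Sum>b\<in>Basis. (snd p \<bullet> b) *\<^sub>R L (fst p) b) - k (fst p)))
        has_derivative \<Phi>' p) (at p)"
      by simp
    then show ?thesis
    proof (rule has_derivative_transform_within_open[OF _ open_Times[OF U(1) open_UNIV] p])
      fix p' assume "p' \<in> U \<times> (UNIV :: 'e set)"
      then have "fst p' \<in> U" by auto
      then show "(fst p', (\<Sum>b\<in>Basis. (snd p' \<bullet> b) *\<^sub>R L (fst p') b) - k (fst p')) = \<Phi> p'"
        unfolding \<Phi>_def using L_sum[of "fst p'" "snd p'"] by simp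
    qed
  qed
  have "(\<Psi> has_derivative \<Psi>' (x, z x)) (at (\<Phi> (x, z x)))"
    using \<Phi>_derivative
  proof (rule has_derivative_inverse_on[OF open_Times[OF U(1) open_UNIV]])
    show "\<Psi> (\<Phi> p) = p" if "p \<in> U \<times> UNIV" for p
      using that L_inv' by (auto simp: \<Phi>_def \<Psi>_def)
    show "\<Phi>' (x, z x) \<circ> \<Psi>' (x, z x) = id"
      using L_inv[OF U(2)] by (auto simp: \<Phi>'_def \<Psi>'_def fun_eq_iff)
  qed (use U in auto)
  moreover have "\<Phi> (x, z x) = (x, 0)"
    using sol[OF U(2)] by (simp add: \<Phi>_def)
  ultimately have "(\<Psi> has_derivative \<Psi>' (x, z x)) (at (x, 0))"
    by simp
  \<comment> \<open>The equation \<open>L y z = k y\<close> says that \<open>\<Phi>\<close> sends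
    \<open>(y, z)\<close> to \<open>(y, 0)\<close>, so the solution is the second component of
    \<open>\<Psi>\<close> along the slice of points \<open>(y, 0)\<close>.\<close>
  from has_derivative_compose[OF has_derivative_Pair[OF has_derivative_ident has_derivative_const]
      this, THEN has_derivative_snd]
  have "(z has_derivative (\<lambda>h. snd (\<Psi>' (x, z x) (h, 0)))) (at x)"
  proof (rule has_derivative_transform_within_open[OF _ U])
    show "snd (\<Psi> (y, 0)) = z y" if "y \<in> U" for y
      using L_inv'[OF that, of "z y"] sol[OF that] by (simp add: \<Psi>_def)
  qed
  then show ?thesis by (rule differentiableI)
qed

text \<open>Nondegeneracy lets the Koszul identity determine its solution, so any verified candidate
  is the value of the definite description. The rule stands outside the locale so that it also
  applies to the product metric.\<close>

lemma christoffel_eqI: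
  assumes "bilinear (g x)" "\<And>u. (\<And>t. g x u t = 0) \<Longrightarrow> u = 0"
    and "\<And>t. 2 * g x z t =
       dir_deriv (\<lambda>y. g y w t) x u + dir_deriv (\<lambda>y. g y u t) x w - dir_deriv (\<lambda>y. g y u w) x t"
  shows "christoffel g x u w = z"
  unfolding christoffel_def
proof (rule the_equality)
  fix z' assume z': "\<forall>t. 2 * g x z' t =
       dir_deriv (\<lambda>y. g y w t) x u + dir_deriv (\<lambda>y. g y u t) x w - dir_deriv (\<lambda>y. g y u w) x t"
  have "g x (z' - z) t = 0" for t
    using assms(3)[of t] z'[rule_format, of t] by (simp add: bilinear_lsub[OF assms(1)])
  then show "z' = z" using assms(2)[of "z' - z"] by simp
qed (use assms(3) in blast)

locale metric_chart =
  fixes U :: "'e::euclidean_space set" and g :: "'e \<Rightarrow> 'e \<Rightarrow> 'e \<Rightarrow> real"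
  assumes open_U: "open U"
    and bilinear: "x \<in> U \<Longrightarrow> bilinear (g x)"
    and g_sym: "x \<in> U \<Longrightarrow> g x u w = g x w u"
    and nondegenerate: "x \<in> U \<Longrightarrow> (\<And>w. g x u w = 0) \<Longrightarrow> u = 0"
    and smooth: "smooth_on U (\<lambda>x. g x u w)"
begin

definition Dg :: "'e \<Rightarrow> 'e \<Rightarrow> 'e \<Rightarrow> 'e \<Rightarrow> real" where
  "Dg x u w t = dir_deriv (\<lambda>y. g y w t) x u"

text \<open>Twice the Christoffel symbol of the first kind. In \<open>Dg\<close> the direction of
  differentiation precedes the two arguments of the metric.\<close>

definition koszul :: "'e \<Rightarrow> 'e \<Rightarrow> 'e \<Rightarrow> 'e \<Rightarrow> real" where
  "koszul x u w t = Dg x u w t + Dg x w u t - Dg x t u w"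

text \<open>Lowering of an index, with covectors identified with vectors by the Euclidean inner
  product; the Koszul identity becomes a linear equation within \<open>'e\<close>.\<close>

definition flat :: "'e \<Rightarrow> 'e \<Rightarrow> 'e" where
  "flat x z = (\<Sum>b\<in>Basis. g x z b *\<^sub>R b)"

lemma g_has_derivative:
  "x \<in> U \<Longrightarrow> ((\<lambda>y. g y w t) has_derivative (\<lambda>u. Dg x u w t)) (at x)"
  unfolding Dg_def dir_deriv_def by (rule smooth_on_has_derivative[OF open_U smooth])

lemma g_differentiable: "x \<in> U \<Longrightarrow> (\<lambda>y. g y w t) differentiable (at x)"
  using g_has_derivative by (rule differentiableI)

lemma Dg_linear: "x \<in> U \<Longrightarrow> linear (\<lambda>u. Dg x u w t)"
  using g_has_derivative has_derivative_linear by blast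

lemma Dg_sym: "x \<in> U \<Longrightarrow> Dg x u w t = Dg x u t w"
  unfolding Dg_def[of x u w t]
  by (rule dir_deriv_eqI[OF g_has_derivative open_U]) (simp_all add: g_sym)

text \<open>Linearity of the metric in one slot holds on the whole open set \<open>U\<close>, hence
  can be differentiated.\<close>

lemma Dg_linear_right:
  assumes "x \<in> U"
  shows "linear (Dg x u w)"
proof
  fix t t' c
  show "Dg x u w (t + t') = Dg x u w t + Dg x u w t'"
    unfolding Dg_def[of x u w "t + t'"]
    by (rule dir_deriv_eqI[OF has_derivative_add[OF g_has_derivative[of x w t]
            g_has_derivative[of x w t']] open_U])
      (use assms in \<open>simp_all add: bilinear_radd[OF bilinear]\<close>)
  show "Dg x u w (c *\<^sub>R t) = c *\<^sub>R Dg x u w t"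
    unfolding Dg_def[of x u w "c *\<^sub>R t"]
    by (rule dir_deriv_eqI[OF has_derivative_scaleR_right[OF g_has_derivative[of x w t]] open_U])
      (use assms in \<open>simp_all add: bilinear_rmul[OF bilinear]\<close>)
qed

lemma Dg_linear_mid: "x \<in> U \<Longrightarrow> linear (\<lambda>w. Dg x u w t)"
  using Dg_linear_right[of x u t] by (simp add: Dg_sym[of x u _ t])

lemma koszul_linear: "x \<in> U \<Longrightarrow> linear (koszul x u w)"
  unfolding koszul_def
  by (intro linear_compose_add linear_compose_sub Dg_linear Dg_linear_right)

lemma koszul_linear_mid: "x \<in> U \<Longrightarrow> linear (\<lambda>w. koszul x u w t)"
  unfolding koszul_def
  by (intro linear_compose_add linear_compose_sub Dg_linear Dg_linear_right Dg_linear_mid)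

lemma koszul_sym: "x \<in> U \<Longrightarrow> koszul x u w t = koszul x w u t"
  by (simp add: koszul_def Dg_sym[of x t u w])

lemma inner_flat:
  assumes "x \<in> U"
  shows "flat x z \<bullet> t = g x z t"
proof -
  have "linear (g x z)" using bilinear[OF assms] by (simp add: bilinear_def)
  then have "g x z t = (\<Sum>b\<in>Basis. (t \<bullet> b) *\<^sub>R g x z b)"
    by (subst euclidean_representation[of t, symmetric]) (simp only: linear_sum linear_scale)
  then show ?thesis by (simp add: flat_def inner_sum_left inner_commute[of t] mult.commute)
qed

lemma flat_linear: "x \<in> U \<Longrightarrow> linear (flat x)"
  unfolding flat_def using bilinear_ladd[OF bilinear] bilinear_lmul[OF bilinear]
  by (intro linearI) (auto simp: scaleR_left_distrib sum.distrib scaleR_sum_right)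

lemma flat_eq_0: "x \<in> U \<Longrightarrow> flat x z = 0 \<Longrightarrow> z = 0"
  using nondegenerate inner_flat by (metis inner_zero_left)

lemma christoffel_unique:
  assumes "x \<in> U" "\<And>t. 2 * g x z t = koszul x u w t"
  shows "christoffel g x u w = z"
  using assms nondegenerate
  by (intro christoffel_eqI bilinear) (auto simp: koszul_def Dg_def)

text \<open>This is the existence half of the definite description: \<open>flat x\<close> is an
  injective endomorphism of a finite-dimensional space, hence onto.\<close>

lemma g_christoffel:
  assumes "x \<in> U"
  shows "2 * g x (christoffel g x u w) t = koszul x u w t"
proof -
  have "surj (flat x)"
    using flat_linear flat_eq_0 assms
    by (intro linear_inj_imp_surj) (auto simp: linear_injective_0)
  \<comment> \<open>The right-hand side is the Euclidean representative of half the linear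
    functional \<open>koszul x u w\<close>.\<close>
  then obtain z where z: "flat x z = (\<Sum>b\<in>Basis. (koszul x u w b / 2) *\<^sub>R b)"
    by (metis surjD)
  have *: "2 * g x z t = koszul x u w t" for t
  proof -
    have "koszul x u w t = (\<Sum>b\<in>Basis. (t \<bullet> b) *\<^sub>R koszul x u w b)"
      by (subst euclidean_representation[of t, symmetric])
        (simp only: linear_sum[OF koszul_linear] linear_scale[OF koszul_linear] assms)
    then show ?thesis
      by (simp add: inner_flat[OF assms, symmetric] z inner_sum_left sum_distrib_left
          inner_commute[of t] mult.commute)
  qed
  then have "christoffel g x u w = z" by (rule christoffel_unique[OF assms])
  with * show ?thesis by simp
qed

lemma christoffel_sym: "x \<in> U \<Longrightarrow> christoffel g x u w = christoffel g x w u"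
  by (rule christoffel_unique) (auto simp: g_christoffel koszul_sym[of x u w])

text \<open>Linearity passes from the Koszul identity to its unique solution; with
  \<open>christoffel_sym\<close> it is available in both arguments.\<close>

lemma christoffel_linear:
  assumes "x \<in> U"
  shows "linear (christoffel g x u)"
  by (rule linearI; rule christoffel_unique)
    (use assms in \<open>simp_all add: bilinear_ladd[OF bilinear] bilinear_lmul[OF bilinear]
      linear_add[OF koszul_linear_mid] linear_scale[OF koszul_linear_mid]
      g_christoffel ring_distribs mult.left_commute[of 2]\<close>)

lemma Dg_differentiable:
  assumes "x \<in> U"
  shows "(\<lambda>y. Dg y u w t) differentiable (at x)"
  unfolding Dg_def
  using smooth_on_has_derivative[OF open_U smooth_on_dir_deriv[OF open_U smooth] assms]
  by (rule differentiableI)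

text \<open>The symbol solves a linear system whose matrix and right-hand side are differentiable in
  the base point. The fact is needed because the fibre's symbols occur inside those of the product,
  which get differentiated.\<close>

lemma christoffel_differentiable:
  assumes "x \<in> U"
  shows "(\<lambda>y. christoffel g y u w) differentiable (at x)"
proof (rule linear_system_solution_differentiable[OF open_U assms])
  show "linear (flat y)" if "y \<in> U" for y by (rule flat_linear[OF that])
  show "z = 0" if "y \<in> U" "flat y z = 0" for y z using flat_eq_0 that by blast
  show "(\<lambda>y. flat y z) differentiable (at y)" if "y \<in> U" for y z
    unfolding flat_def using g_differentiable[OF that]
    by (auto intro!: differentiable_sum differentiable_scaleR differentiable_const)
  show "(\<lambda>y. \<Sum>b\<in>Basis. (koszul y u w b / 2) *\<^sub>R b) differentiable (at y)" if "y \<in> U" for y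
    unfolding koszul_def using Dg_differentiable[OF that]
    by (auto intro!: differentiable_sum differentiable_scaleR differentiable_const
        differentiable_divide differentiable_diff differentiable_add)
  show "flat y (christoffel g y u w) = (\<Sum>b\<in>Basis. (koszul y u w b / 2) *\<^sub>R b)"
    if "y \<in> U" for y
    using g_christoffel[OF that, symmetric] by (simp add: flat_def)
qed

lemma christoffel_has_derivative:
  "x \<in> U \<Longrightarrow> ((\<lambda>y. christoffel g y w t) has_derivative
     dir_deriv (\<lambda>y. christoffel g y w t) x) (at x)"
  using christoffel_differentiable[unfolded frechet_derivative_works, of x w t]
  by (simp add: dir_deriv_def[abs_def])

end

subsection \<open>Ricci curvature of a warped product with an interval\<close>

lemma has_derivative_real_fst:
  assumes "(f has_real_derivative f') (at (fst z))"
  shows "((\<lambda>z::real \<times> 'e::real_normed_vector. f (fst z)) has_derivative (\<lambda>h. f' * fst h)) (at z)"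
  by (rule has_derivative_compose[OF has_derivative_fst[OF has_derivative_ident]
        assms[unfolded has_field_derivative_def]])

lemma has_derivative_snd_compose:
  assumes "(f has_derivative D) (at (snd z))"
  shows "((\<lambda>z::real \<times> 'e::real_normed_vector. f (snd z)) has_derivative (\<lambda>h. D (snd h))) (at z)"
  by (rule has_derivative_compose[OF has_derivative_snd[OF has_derivative_ident] assms])

lemma sum_Basis_prod:
  fixes f :: "'a::euclidean_space \<times> 'b::euclidean_space \<Rightarrow> 'c::comm_monoid_add"
  shows "(\<Sum>b\<in>Basis. f b) = (\<Sum>b\<in>Basis. f (b, 0)) + (\<Sum>b\<in>Basis. f (0, b))"
proof -
  have "inj_on (\<lambda>u. (u::'a, 0::'b)) Basis" "inj_on (\<lambda>u. (0::'a, u::'b)) Basis"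
    by (auto intro!: inj_onI)
  then show ?thesis
    unfolding Basis_prod_def
    by (subst sum.union_disjoint) (auto simp: sum.reindex Basis_prod_def)
qed

text \<open>The metric \<open>a dr\<^sup>2 + b g\<close>, whose Christoffel symbols are expressed through \<open>p = a'/(2a)\<close>,
  \<open>q = b'/(2a)\<close> and \<open>s = b'/(2b)\<close>.\<close>

locale warped_chart = metric_chart U g
  for U :: "'e::euclidean_space set" and g :: "'e \<Rightarrow> 'e \<Rightarrow> 'e \<Rightarrow> real" +
  fixes B :: "real set" and a b a' b' p q s p' q' s' :: "real \<Rightarrow> real"
    and G :: "real \<times> 'e \<Rightarrow> real \<times> 'e \<Rightarrow> real \<times> 'e \<Rightarrow> real"
  assumes open_B: "open B"
    and a_nonzero: "r \<in> B \<Longrightarrow> a r \<noteq> 0" and b_nonzero: "r \<in> B \<Longrightarrow> b r \<noteq> 0"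
    and a_deriv: "r \<in> B \<Longrightarrow> (a has_real_derivative a' r) (at r)"
    and b_deriv: "r \<in> B \<Longrightarrow> (b has_real_derivative b' r) (at r)"
    and p_deriv: "r \<in> B \<Longrightarrow> (p has_real_derivative p' r) (at r)"
    and q_deriv: "r \<in> B \<Longrightarrow> (q has_real_derivative q' r) (at r)"
    and s_deriv: "r \<in> B \<Longrightarrow> (s has_real_derivative s' r) (at r)"
    and p_eq: "r \<in> B \<Longrightarrow> 2 * a r * p r = a' r"
    and q_eq: "r \<in> B \<Longrightarrow> 2 * a r * q r = b' r"
    and s_eq: "r \<in> B \<Longrightarrow> 2 * b r * s r = b' r"
    and G_eq: "r \<in> B \<Longrightarrow> y \<in> U \<Longrightarrow>
      G (r, y) (\<alpha>, u) (\<beta>, w) = a r * (\<alpha> * \<beta>) + b r * g y u w"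
begin

lemma open_BU: "open (B \<times> U)"
  by (intro open_Times open_B open_U)

lemma G_bilinear:
  assumes "r \<in> B" "y \<in> U"
  shows "bilinear (G (r, y))"
  unfolding bilinear_def
  by (auto intro!: linearI simp: G_eq[OF assms] bilinear_ladd[OF bilinear] bilinear_lmul[OF bilinear]
      bilinear_radd[OF bilinear] bilinear_rmul[OF bilinear] assms algebra_simps)

lemma G_nondegenerate:
  assumes "r \<in> B" "y \<in> U" "\<And>t. G (r, y) z t = 0"
  shows "z = 0"
proof -
  obtain \<alpha> u where z: "z = (\<alpha>, u)" by (cases z)
  have "G (r, y) (\<alpha>, u) (1, 0) = 0" using assms(3) z by simp
  then have \<alpha>: "\<alpha> = 0"
    using assms a_nonzero by (simp add: G_eq bilinear_rzero[OF bilinear])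
  have "g y u w = 0" for w
    using assms(3)[of "(0, w)"] b_nonzero[OF assms(1)] z by (simp add: G_eq assms(1,2))
  with nondegenerate[OF assms(2)] \<alpha> z show ?thesis by (simp add: zero_prod_def)
qed

lemma dir_deriv_G:
  assumes "r \<in> B" "y \<in> U"
  shows "dir_deriv (\<lambda>z. G z (\<beta>, w) (\<gamma>, t)) (r, y) (\<alpha>, u) =
    \<alpha> * (a' r * (\<beta> * \<gamma>) + b' r * g y w t) + b r * Dg y u w t"
proof -
  have D: "((\<lambda>z. a (fst z) * (\<beta> * \<gamma>) + b (fst z) * g (snd z) w t) has_derivative
      (\<lambda>h. (a' r * fst h) * (\<beta> * \<gamma>) + (b r * Dg y (snd h) w t + (b' r * fst h) * g y w t)))
      (at (r, y))"
    using has_derivative_real_fst[of a "a' r" "(r, y)"] has_derivative_real_fst[of b "b' r" "(r, y)"]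
      has_derivative_snd_compose[of "\<lambda>y. g y w t" "\<lambda>u. Dg y u w t" "(r, y)"]
      a_deriv b_deriv g_has_derivative assms
    by (intro has_derivative_add has_derivative_mult_left has_derivative_mult[THEN has_derivative_eq_rhs])
      auto
  then show ?thesis
    by (subst dir_deriv_eqI[OF D open_BU]) (use assms in \<open>auto simp: G_eq algebra_simps\<close>)
qed

text \<open>Substituting the candidate into the Koszul identity produces exactly the products 2ap,
  2aq and 2bs, which are replaced by coefficient derivatives without division. Here \<open>p\<close>
  is the symbol of the base, \<open>q\<close> the base component caused by the varying fibre size,
  and \<open>s\<close> the mixed symbol.\<close>

lemma christoffel_G:
  assumes "r \<in> B" "y \<in> U"
  shows "christoffel G (r, y) (\<alpha>, u) (\<beta>, w) =
    (p r * (\<alpha> * \<beta>) - q r * g y u w, s r *\<^sub>R (\<alpha> *\<^sub>R w + \<beta> *\<^sub>R u) + christoffel g y u w)"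
proof (rule christoffel_eqI)
  show "bilinear (G (r, y))" by (rule G_bilinear[OF assms])
  show "z = 0" if "\<And>t. G (r, y) z t = 0" for z using G_nondegenerate[OF assms that] .
  fix h :: "real \<times> 'e"
  obtain \<gamma> t where h: "h = (\<gamma>, t)" by (cases h)
  have "2 * G (r, y) (p r * (\<alpha> * \<beta>) - q r * g y u w,
        s r *\<^sub>R (\<alpha> *\<^sub>R w + \<beta> *\<^sub>R u) + christoffel g y u w) (\<gamma>, t) =
      (2 * a r * p r) * (\<alpha> * \<beta> * \<gamma>) - (2 * a r * q r) * g y u w * \<gamma>
      + (2 * b r * s r) * (\<alpha> * g y w t + \<beta> * g y u t) + b r * (2 * g y (christoffel g y u w) t)"
    by (simp add: G_eq assms bilinear_ladd[OF bilinear] bilinear_lmul[OF bilinear] algebra_simps)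
  also have "\<dots> = a' r * (\<alpha> * \<beta> * \<gamma>) - b' r * g y u w * \<gamma>
      + b' r * (\<alpha> * g y w t + \<beta> * g y u t) + b r * koszul y u w t"
    by (simp only: p_eq q_eq s_eq g_christoffel assms)
  also have "\<dots> = dir_deriv (\<lambda>z. G z (\<beta>, w) (\<gamma>, t)) (r, y) (\<alpha>, u)
      + dir_deriv (\<lambda>z. G z (\<alpha>, u) (\<gamma>, t)) (r, y) (\<beta>, w)
      - dir_deriv (\<lambda>z. G z (\<alpha>, u) (\<beta>, w)) (r, y) (\<gamma>, t)"
    by (simp add: dir_deriv_G assms koszul_def algebra_simps)
  finally show "2 * G (r, y) (p r * (\<alpha> * \<beta>) - q r * g y u w,
        s r *\<^sub>R (\<alpha> *\<^sub>R w + \<beta> *\<^sub>R u) + christoffel g y u w) h =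
      dir_deriv (\<lambda>z. G z (\<beta>, w) h) (r, y) (\<alpha>, u) + dir_deriv (\<lambda>z. G z (\<alpha>, u) h) (r, y) (\<beta>, w)
      - dir_deriv (\<lambda>z. G z (\<alpha>, u) (\<beta>, w)) (r, y) h"
    by (simp add: h)
qed

lemma dir_deriv_christoffel_G:
  assumes "r \<in> B" "y \<in> U"
  shows "dir_deriv (\<lambda>z. christoffel G z (\<beta>, w) (\<gamma>, t)) (r, y) (\<alpha>, u) =
    (p' r * \<alpha> * (\<beta> * \<gamma>) - q' r * \<alpha> * g y w t - q r * Dg y u w t,
     (s' r * \<alpha>) *\<^sub>R (\<beta> *\<^sub>R t + \<gamma> *\<^sub>R w) + dir_deriv (\<lambda>y. christoffel g y w t) y u)"
proof -
  have D: "((\<lambda>z. (p (fst z) * (\<beta> * \<gamma>) - q (fst z) * g (snd z) w t,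
          s (fst z) *\<^sub>R (\<beta> *\<^sub>R t + \<gamma> *\<^sub>R w) + christoffel g (snd z) w t)) has_derivative
      (\<lambda>h. ((p' r * fst h) * (\<beta> * \<gamma>) - (q r * Dg y (snd h) w t + (q' r * fst h) * g y w t),
          (s' r * fst h) *\<^sub>R (\<beta> *\<^sub>R t + \<gamma> *\<^sub>R w)
          + dir_deriv (\<lambda>y. christoffel g y w t) y (snd h)))) (at (r, y))"
    using has_derivative_real_fst[of p "p' r" "(r, y)"] has_derivative_real_fst[of q "q' r" "(r, y)"]
      has_derivative_real_fst[of s "s' r" "(r, y)"]
      has_derivative_snd_compose[of "\<lambda>y. g y w t" "\<lambda>u. Dg y u w t" "(r, y)"]
      has_derivative_snd_compose[of "\<lambda>y. christoffel g y w t"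
        "dir_deriv (\<lambda>y. christoffel g y w t) y" "(r, y)"]
      p_deriv q_deriv s_deriv g_has_derivative christoffel_has_derivative assms
    by (intro has_derivative_Pair has_derivative_add has_derivative_diff has_derivative_mult_left
        has_derivative_scaleR_left has_derivative_mult[THEN has_derivative_eq_rhs]) auto
  then show ?thesis
    by (subst dir_deriv_eqI[OF D open_BU]) (use assms in \<open>auto simp: christoffel_G algebra_simps\<close>)
qed

text \<open>The Ricci trace uses only diagonal components: the base component for the base direction
  here, and the fibre component for fibre directions in \<open>curvature_G_vertical\<close>.\<close>

lemma curvature_G_horizontal:
  assumes "r \<in> B" "y \<in> U"
  shows "fst (curvature G (r, y) (1, 0) (\<beta>, w) (\<gamma>, t)) = (q r * s r - q' r - p r * q r) * g y w t"
  using linear_0[OF Dg_linear[OF assms(2)]]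
  by (simp add: curvature_def dir_deriv_christoffel_G christoffel_G assms christoffel_sym[of y 0]
      linear_0[OF christoffel_linear] bilinear_rzero[OF bilinear] bilinear_lzero[OF bilinear]
      bilinear_rmul[OF bilinear] bilinear_lmul[OF bilinear] linear_0[OF Dg_linear_mid]
      algebra_simps)

text \<open>Beyond the fibre curvature there are a multiple of \<open>u\<close>, whose trace brings
  in the dimension, and a rank-one map onto the line of \<open>w\<close>, whose trace is a value of
  the metric.\<close>

lemma curvature_G_vertical:
  assumes "r \<in> B" "y \<in> U"
  shows "snd (curvature G (r, y) (0, u) (\<beta>, w) (\<gamma>, t)) = curvature g y u w t
    + ((s r * p r - s' r - (s r)\<^sup>2) * (\<beta> * \<gamma>) - s r * q r * g y w t) *\<^sub>R u
    + (s r * q r * g y u t) *\<^sub>R w"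
  by (simp add: curvature_def dir_deriv_christoffel_G christoffel_G assms
      linear_add[OF christoffel_linear] linear_scale[OF christoffel_linear]
      christoffel_sym[of y w u] power2_eq_square algebra_simps)

text \<open>The factor 2 - DIM of \<open>q r * s r\<close> collects 1 from the base direction, -DIM
  from the multiple of the identity, and 1 from the rank-one map.\<close>

lemma ricci_G:
  assumes "r \<in> B" "y \<in> U"
  shows "ricci G (r, y) (\<beta>, w) (\<gamma>, t) = ricci g y w t
    + DIM('e) * (s r * p r - s' r - (s r)\<^sup>2) * (\<beta> * \<gamma>)
    + (- q' r - p r * q r + (2 - real DIM('e)) * (q r * s r)) * g y w t"
proof -
  \<comment> \<open>A trace is independent of the basis, so the Euclidean basis serves although it
    need not be orthonormal for \<open>g y\<close>.\<close>
  have "(\<Sum>b\<in>Basis. g y b t * (w \<bullet> b)) = g y t w"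
    using inner_flat[OF assms(2), of t w]
    by (simp add: flat_def inner_sum_left g_sym[OF assms(2), of t] inner_commute[of w])
  then have trace: "(\<Sum>b\<in>Basis. g y b t * (w \<bullet> b)) = g y w t"
    using g_sym[OF assms(2)] by simp
  have "ricci G (r, y) (\<beta>, w) (\<gamma>, t) = (q r * s r - q' r - p r * q r) * g y w t
      + (\<Sum>b\<in>Basis. (curvature g y b w t
        + ((s r * p r - s' r - (s r)\<^sup>2) * (\<beta> * \<gamma>) - s r * q r * g y w t) *\<^sub>R b
        + (s r * q r * g y b t) *\<^sub>R w) \<bullet> b)"
    by (simp add: ricci_def sum_Basis_prod inner_prod_def curvature_G_horizontal
        curvature_G_vertical assms)
  also have "\<dots> = (q r * s r - q' r - p r * q r) * g y w t + ricci g y w t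
      + DIM('e) * ((s r * p r - s' r - (s r)\<^sup>2) * (\<beta> * \<gamma>) - s r * q r * g y w t)
      + s r * q r * (\<Sum>b\<in>Basis. g y b t * (w \<bullet> b))"
    by (simp add: ricci_def inner_add_left sum.distrib sum_distrib_left mult.assoc)
  finally show ?thesis unfolding trace by (simp add: algebra_simps)
qed

end

subsection \<open>Products of manifolds\<close>

lemma connected_manifold_chart:
  assumes "connected_manifold A" "i \<in> index A"
  shows manifold_open_dom: "open (dom A i)"
    and manifold_open_coords: "open (coords A i)"
    and manifold_chart_homeomorphism:
      "homeomorphism (dom A i) (coords A i) (chart A i) (param A i)"
    and manifold_inj_on_chart: "inj_on (chart A i) (dom A i)"
proof -
  show "open (dom A i)" "open (coords A i)"
    and h: "homeomorphism (dom A i) (coords A i) (chart A i) (param A i)"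
    using assms by (auto simp: connected_manifold_def)
  show "inj_on (chart A i) (dom A i)"
    using homeomorphism_apply1[OF h] by (rule inj_on_inverseI)
qed

lemma param_chart:
  assumes "connected_manifold A" "i \<in> index A"
  shows "p \<in> dom A i \<Longrightarrow> param A i (chart A i p) = p"
    and "x \<in> coords A i \<Longrightarrow> param A i x \<in> dom A i"
    and "x \<in> coords A i \<Longrightarrow> chart A i (param A i x) = x"
  using manifold_inj_on_chart[OF assms]
  by (auto simp: param_def coords_def inv_into_into f_inv_into_f)

lemma param_in_carrier:
  "connected_manifold A \<Longrightarrow> i \<in> index A \<Longrightarrow> x \<in> coords A i \<Longrightarrow> param A i x \<in> carrier A"
  using param_chart(2) by (fastforce simp: carrier_def)

lemma carrierE:
  assumes "connected_manifold A" "p \<in> carrier A"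
  obtains i x where "i \<in> index A" "x \<in> coords A i" "p = param A i x"
  using assms param_chart(1) by (fastforce simp: carrier_def coords_def)

lemma overlap_subset_coords: "chart A i ` (dom A i \<inter> dom A j) \<subseteq> coords A i"
  by (auto simp: coords_def)

lemma open_overlap:
  assumes "connected_manifold A" "i \<in> index A" "j \<in> index A"
  shows "open (chart A i ` (dom A i \<inter> dom A j))"
proof -
  have "openin (top_of_set (dom A i)) (dom A i \<inter> dom A j)"
    using manifold_open_dom[OF assms(1)] assms(3) by (simp add: openin_open_Int)
  then have "openin (top_of_set (coords A i)) (chart A i ` (dom A i \<inter> dom A j))"
    by (rule homeomorphism_imp_open_map[OF manifold_chart_homeomorphism[OF assms(1,2)]])
  then show ?thesis
    using manifold_open_coords[OF assms(1,2)] openin_open_eq by blast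
qed

lemma param_transition:
  assumes "connected_manifold A" "i \<in> index A" "j \<in> index A"
    and "x \<in> chart A i ` (dom A i \<inter> dom A j)"
  shows "param A j (transition A i j x) = param A i x"
  using assms param_chart(1) by (fastforce simp: transition_def)

lemma transition_smooth:
  assumes "connected_manifold A" "i \<in> index A" "j \<in> index A"
  shows "smooth_on (chart A i ` (dom A i \<inter> dom A j)) (transition A i j)"
  using assms by (simp add: connected_manifold_def)

lemma index_product_atlas [simp]: "index (product_atlas A A') = index A \<times> index A'"
  and dom_product_atlas [simp]: "dom (product_atlas A A') (i, j) = dom A i \<times> dom A' j"
  and chart_product_atlas [simp]:
    "chart (product_atlas A A') (i, j) z = (chart A i (fst z), chart A' j (snd z))"
  by (auto simp: product_atlas_def split: prod.splits)

lemma coords_product_atlas [simp]: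
  "coords (product_atlas A A') (i, j) = coords A i \<times> coords A' j"
  by (force simp: coords_def)

lemma carrier_product_atlas [simp]:
  "carrier (product_atlas A A') = carrier A \<times> carrier A'"
  by (force simp: carrier_def)

lemma overlap_product_atlas:
  "chart (product_atlas A A') (i, j) `
      (dom (product_atlas A A') (i, j) \<inter> dom (product_atlas A A') (k, l)) =
    chart A i ` (dom A i \<inter> dom A k) \<times> chart A' j ` (dom A' j \<inter> dom A' l)"
  by force

text \<open>\<open>inv_into\<close> is controlled only on the image of the chart. Statements about
  product parametrisations are therefore confined to coordinate domains, and smoothness is
  transferred by congruence on these open sets.\<close>

lemma param_product_atlas:
  assumes "connected_manifold A" "connected_manifold A'" "i \<in> index A" "j \<in> index A'"
    and "x \<in> coords A i" "y \<in> coords A' j"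
  shows "param (product_atlas A A') (i, j) (x, y) = (param A i x, param A' j y)"
  unfolding param_def[of "product_atlas A A'"]
proof (rule inv_into_f_eq)
  show "inj_on (chart (product_atlas A A') (i, j)) (dom (product_atlas A A') (i, j))"
    using manifold_inj_on_chart[OF assms(1,3)] manifold_inj_on_chart[OF assms(2,4)]
    by (auto simp: inj_on_def)
qed (use param_chart[OF assms(1,3)] param_chart[OF assms(2,4)] assms(5,6) in auto)

lemma transition_product_atlas:
  assumes "connected_manifold A" "connected_manifold A'" "i \<in> index A" "j \<in> index A'"
    and "x \<in> coords A i" "y \<in> coords A' j"
  shows "transition (product_atlas A A') (i, j) (k, l) (x, y) =
    (transition A i k x, transition A' j l y)"
  by (simp add: transition_def param_product_atlas assms)

lemma connected_manifold_product_atlas: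
  fixes A :: "('i, 'a::{second_countable_topology, t2_space}, 'd::euclidean_space) atlas"
    and A' :: "('j, 'b::{second_countable_topology, t2_space}, 'e::euclidean_space) atlas"
  assumes A: "connected_manifold A" and A': "connected_manifold A'"
  shows "connected_manifold (product_atlas A A')"
  unfolding connected_manifold_def
proof (intro conjI ballI)
  fix c assume "c \<in> index (product_atlas A A')"
  then obtain i j where c: "c = (i, j)" and i: "i \<in> index A" and j: "j \<in> index A'" by auto
  show "open (dom (product_atlas A A') c)" "open (coords (product_atlas A A') c)"
    by (simp_all add: c open_Times manifold_open_dom manifold_open_coords A A' i j)
  note h = manifold_chart_homeomorphism[OF A i] and h' = manifold_chart_homeomorphism[OF A' j]
  have "homeomorphism (dom A i \<times> dom A' j) (coords A i \<times> coords A' j)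
     (\<lambda>z. (chart A i (fst z), chart A' j (snd z))) (\<lambda>z. (param A i (fst z), param A' j (snd z)))"
  proof (rule homeomorphismI)
    show "continuous_on (dom A i \<times> dom A' j) (\<lambda>z. (chart A i (fst z), chart A' j (snd z)))"
      "continuous_on (coords A i \<times> coords A' j) (\<lambda>z. (param A i (fst z), param A' j (snd z)))"
      using homeomorphism_cont1[OF h] homeomorphism_cont1[OF h']
        homeomorphism_cont2[OF h] homeomorphism_cont2[OF h']
      by (auto intro!: continuous_on_Pair elim!: continuous_on_compose2
          intro: continuous_on_fst continuous_on_snd continuous_on_id)
  qed (use param_chart[OF A i] param_chart[OF A' j] in \<open>auto simp: coords_def\<close>)
  then show "homeomorphism (dom (product_atlas A A') c) (coords (product_atlas A A') c)
      (chart (product_atlas A A') c) (param (product_atlas A A') c)"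
    by (rule homeomorphism_cong) (auto simp: c param_product_atlas A A' i j)
  fix d assume "d \<in> index (product_atlas A A')"
  then obtain k l where d: "d = (k, l)" and k: "k \<in> index A" and l: "l \<in> index A'" by auto
  let ?O = "chart A i ` (dom A i \<inter> dom A k)" and ?O' = "chart A' j ` (dom A' j \<inter> dom A' l)"
  have open_O: "open ?O" "open ?O'" by (simp_all add: open_overlap A A' i j k l)
  have "smooth_on (?O \<times> ?O') (\<lambda>z. (transition A i k (fst z), transition A' j l (snd z)))"
    by (intro smooth_on_Pair smooth_on_fst[OF open_O] smooth_on_snd[OF open_O] open_Times open_O
        transition_smooth A A' i j k l)
  then show "smooth_on (chart (product_atlas A A') c `
      (dom (product_atlas A A') c \<inter> dom (product_atlas A A') d))
      (transition (product_atlas A A') c d)"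
    unfolding c d overlap_product_atlas
    using overlap_subset_coords[of A i k] overlap_subset_coords[of A' j l]
    by (subst smooth_on_cong[OF open_Times[OF open_O]])
      (auto simp: transition_product_atlas A A' i j subset_iff)
qed (use A A' in \<open>auto simp: connected_manifold_def connected_Times\<close>)

lemma smooth_function_fst:
  assumes "connected_manifold A" "connected_manifold A'" "smooth_function A h"
  shows "smooth_function (product_atlas A A') (\<lambda>(p, _). h p)"
  unfolding smooth_function_def
proof
  fix c assume "c \<in> index (product_atlas A A')"
  then obtain i j where c: "c = (i, j)" and i: "i \<in> index A" and j: "j \<in> index A'" by auto
  have "open (coords A i)" "open (coords A' j)"
    by (simp_all add: manifold_open_coords assms i j)
  moreover have "smooth_on (coords A i) (h \<circ> param A i)"
    using assms(3) i by (simp add: smooth_function_def)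
  ultimately have "smooth_on (coords A i \<times> coords A' j) (\<lambda>z. (h \<circ> param A i) (fst z))"
    by (rule smooth_on_fst)
  then show "smooth_on (coords (product_atlas A A') c)
      ((\<lambda>(p, _). h p) \<circ> param (product_atlas A A') c)"
    using \<open>open (coords A i)\<close> \<open>open (coords A' j)\<close> unfolding c coords_product_atlas
    by (subst smooth_on_cong[OF open_Times]) (auto simp: param_product_atlas assms i j)
qed

section \<open>Transition maps and metrics on products\<close>

lemma has_derivative_map_prod:
  fixes f :: "'a::real_normed_vector \<Rightarrow> 'c::real_normed_vector"
    and h :: "'b::real_normed_vector \<Rightarrow> 'd::real_normed_vector"
  assumes "(f has_derivative f') (at x)" "(h has_derivative h') (at y)"
  shows "((\<lambda>z. (f (fst z), h (snd z))) has_derivative (\<lambda>z. (f' (fst z), h' (snd z)))) (at (x, y))"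
  by (intro has_derivative_Pair
      has_derivative_compose[OF has_derivative_fst[OF has_derivative_ident], of f]
      has_derivative_compose[OF has_derivative_snd[OF has_derivative_ident], of h])
    (use assms in auto)

lemma frechet_derivative_transition_product_atlas:
  assumes A: "connected_manifold A" "i \<in> index A" "k \<in> index A"
    and A': "connected_manifold A'" "j \<in> index A'" "l \<in> index A'"
    and x: "x \<in> chart A i ` (dom A i \<inter> dom A k)" and y: "y \<in> chart A' j ` (dom A' j \<inter> dom A' l)"
  shows "frechet_derivative (transition (product_atlas A A') (i, j) (k, l)) (at (x, y)) (u, w) =
    (frechet_derivative (transition A i k) (at x) u, frechet_derivative (transition A' j l) (at y) w)"
proof -
  have "frechet_derivative (transition (product_atlas A A') (i, j) (k, l)) (at (x, y)) =
      frechet_derivative (\<lambda>z. (transition A i k (fst z), transition A' j l (snd z))) (at (x, y))"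
    using x y overlap_subset_coords[of A i k] overlap_subset_coords[of A' j l]
    by (intro frechet_derivative_cong_open[OF open_Times[OF open_overlap[OF A] open_overlap[OF A']]])
      (auto simp: transition_product_atlas A A' subset_iff)
  also have "\<dots> = (\<lambda>z. (frechet_derivative (transition A i k) (at x) (fst z),
      frechet_derivative (transition A' j l) (at y) (snd z)))"
    by (rule frechet_derivative_at[symmetric, OF has_derivative_map_prod])
      (rule smooth_on_has_derivative[OF open_overlap transition_smooth], (rule A A' x y)+)+
  finally show ?thesis by simp
qed

text \<open>The weights may have either sign, in keeping with indefinite metrics; nondegeneracy asks
  only that they do not vanish.\<close>

lemma pseudo_riemannian_weighted_product_metric:
  fixes A :: "('i, 'a::{second_countable_topology, t2_space}, 'd::euclidean_space) atlas"
    and A' :: "('j, 'b::{second_countable_topology, t2_space}, 'e::euclidean_space) atlas"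
  assumes A: "connected_manifold A" "pseudo_riemannian_metric A g"
    and A': "connected_manifold A'" "pseudo_riemannian_metric A' g'"
    and f: "smooth_function (product_atlas A A') f" "\<And>p. p \<in> carrier A \<times> carrier A' \<Longrightarrow> f p \<noteq> 0"
    and f': "smooth_function (product_atlas A A') f'"
      "\<And>p. p \<in> carrier A \<times> carrier A' \<Longrightarrow> f' p \<noteq> 0"
  shows "pseudo_riemannian_metric (product_atlas A A') (weighted_product_metric A A' f g f' g')"
proof -
  let ?P = "product_atlas A A'" and ?h = "weighted_product_metric A A' f g f' g'"
  have h: "?h (i, j) z u w = f (param A i (fst z), param A' j (snd z)) * g i (fst z) (fst u) (fst w)
      + f' (param A i (fst z), param A' j (snd z)) * g' j (snd z) (snd u) (snd w)" for i j z u w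
    by (simp add: weighted_product_metric_def split: prod.splits)
  have g: "bilinear (g i x)" "g i x u w = g i x w u" "(\<And>w. g i x u w = 0) \<Longrightarrow> u = 0"
    if "i \<in> index A" "x \<in> coords A i" for i x u w
    using A(2) that by (auto simp: pseudo_riemannian_metric_def)
  have g': "bilinear (g' i x)" "g' i x u w = g' i x w u" "(\<And>w. g' i x u w = 0) \<Longrightarrow> u = 0"
    if "i \<in> index A'" "x \<in> coords A' i" for i x u w
    using A'(2) that by (auto simp: pseudo_riemannian_metric_def)
  show ?thesis
    unfolding pseudo_riemannian_metric_def
  proof (intro conjI ballI allI impI)
    fix c z assume c: "c \<in> index ?P" and z: "z \<in> coords ?P c"
    obtain i j x y where c_eq: "c = (i, j)" and z_eq: "z = (x, y)" by (cases c, cases z)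
    have i: "i \<in> index A" "x \<in> coords A i" and j: "j \<in> index A'" "y \<in> coords A' j"
      using c z by (auto simp: c_eq z_eq)
    have "(param A i x, param A' j y) \<in> carrier A \<times> carrier A'"
      by (simp add: param_in_carrier A(1) A'(1) i j)
    note nz = f(2)[OF this] f'(2)[OF this]
    show "bilinear (?h c z)"
      unfolding bilinear_def c_eq z_eq h
      by (auto intro!: linearI simp: bilinear_ladd[OF g(1)[OF i]] bilinear_lmul[OF g(1)[OF i]]
          bilinear_radd[OF g(1)[OF i]] bilinear_rmul[OF g(1)[OF i]] bilinear_ladd[OF g'(1)[OF j]]
          bilinear_lmul[OF g'(1)[OF j]] bilinear_radd[OF g'(1)[OF j]] bilinear_rmul[OF g'(1)[OF j]]
          algebra_simps)
    show "?h c z u w = ?h c z w u" for u w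
      unfolding c_eq z_eq h using g(2)[OF i] g'(2)[OF j] by simp
    \<comment> \<open>Pairing with vectors tangent to one factor isolates that factor's
      metric.\<close>
    show "u = 0" if u: "\<forall>w. ?h c z u w = 0" for u
    proof -
      have "g i x (fst u) w = 0" for w
        using u[rule_format, of "(w, 0)"] nz
        by (simp add: c_eq z_eq h bilinear_rzero[OF g'(1)[OF j]])
      moreover have "g' j y (snd u) w = 0" for w
        using u[rule_format, of "(0, w)"] nz
        by (simp add: c_eq z_eq h bilinear_rzero[OF g(1)[OF i]])
      ultimately show "u = 0"
        using g(3)[OF i] g'(3)[OF j] by (simp add: prod_eq_iff)
    qed
  next
    fix c u w assume c: "c \<in> index ?P"
    obtain i j where c_eq: "c = (i, j)" by (cases c)
    have i: "i \<in> index A" and j: "j \<in> index A'" using c by (auto simp: c_eq)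
    have O: "open (coords A i)" "open (coords A' j)"
      by (simp_all add: manifold_open_coords A(1) A'(1) i j)
    have ff: "smooth_on (coords A i \<times> coords A' j) (f \<circ> param ?P (i, j))"
      "smooth_on (coords A i \<times> coords A' j) (f' \<circ> param ?P (i, j))"
      using f(1) f'(1) c unfolding smooth_function_def c_eq coords_product_atlas[symmetric] by auto
    have gg: "smooth_on (coords A i) (\<lambda>x. g i x (fst u) (fst w))"
      "smooth_on (coords A' j) (\<lambda>x. g' j x (snd u) (snd w))"
      using A(2) A'(2) i j by (auto simp: pseudo_riemannian_metric_def)
    have "smooth_on (coords A i \<times> coords A' j)
      (\<lambda>z. (f \<circ> param ?P (i, j)) z * g i (fst z) (fst u) (fst w)
        + (f' \<circ> param ?P (i, j)) z * g' j (snd z) (snd u) (snd w))"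
      by (rule smooth_on_add[OF open_Times[OF O]
            smooth_on_mult[OF open_Times[OF O] ff(1) smooth_on_fst[OF O gg(1)]]
            smooth_on_mult[OF open_Times[OF O] ff(2) smooth_on_snd[OF O gg(2)]]])
    then show "smooth_on (coords ?P c) (\<lambda>z. ?h c z u w)"
      unfolding c_eq coords_product_atlas
      by (subst smooth_on_cong[OF open_Times[OF O]])
        (auto simp: h param_product_atlas A(1) A'(1) i j)
  next
    fix c d z and u w :: "'d \<times> 'e"
    assume c: "c \<in> index ?P" and d: "d \<in> index ?P"
      and z: "z \<in> chart ?P c ` (dom ?P c \<inter> dom ?P d)"
    obtain i j k l x y where eq: "c = (i, j)" "d = (k, l)" "z = (x, y)"
      by (cases c, cases d, cases z)
    have i: "i \<in> index A" "k \<in> index A" and j: "j \<in> index A'" "l \<in> index A'"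
      using c d by (auto simp: eq)
    have x: "x \<in> chart A i ` (dom A i \<inter> dom A k)" and y: "y \<in> chart A' j ` (dom A' j \<inter> dom A' l)"
      using z unfolding eq overlap_product_atlas by auto
    have xy: "x \<in> coords A i" "y \<in> coords A' j"
      using x overlap_subset_coords[of A i k] y overlap_subset_coords[of A' j l] by blast+
    obtain u1 u2 w1 w2 where uw: "u = (u1, u2)" "w = (w1, w2)" by (cases u, cases w)
    have "g i x u1 w1 = g k (transition A i k x) (frechet_derivative (transition A i k) (at x) u1)
        (frechet_derivative (transition A i k) (at x) w1)"
      using A(2) i x unfolding pseudo_riemannian_metric_def by blast
    moreover have "g' j y u2 w2 = g' l (transition A' j l y)
        (frechet_derivative (transition A' j l) (at y) u2)
        (frechet_derivative (transition A' j l) (at y) w2)"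
      using A'(2) j y unfolding pseudo_riemannian_metric_def by blast
    \<comment> \<open>The weights are functions of points, and by \<open>param_transition\<close>
      both charts parametrise the same point, so only the factor metrics transform.\<close>
    ultimately show "?h c z u w = ?h d (transition ?P c d z)
        (frechet_derivative (transition ?P c d) (at z) u)
        (frechet_derivative (transition ?P c d) (at z) w)"
      unfolding eq uw
      by (simp add: h transition_product_atlas[OF A(1) A'(1) i(1) j(1) xy]
          frechet_derivative_transition_product_atlas[OF A(1) i A'(1) j x y]
          param_transition[OF A(1) i x] param_transition[OF A'(1) j y])
  qed
qed

section \<open>The open interval as a pseudo-Riemannian manifold\<close>

lemma interval_atlas_simps [simp]:
  "index (interval_atlas B) = UNIV" "dom (interval_atlas B) i = B"
  "chart (interval_atlas B) i = (\<lambda>r. r)" "coords (interval_atlas B) i = B"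
  "carrier (interval_atlas B) = B"
  by (auto simp: interval_atlas_def coords_def carrier_def)

lemma param_interval_atlas [simp]: "r \<in> B \<Longrightarrow> param (interval_atlas B) i r = r"
  unfolding param_def interval_atlas_simps by (rule inv_into_f_eq) auto

lemma connected_manifold_interval_atlas:
  assumes "open B" "is_interval B" "B \<noteq> {}"
  shows "connected_manifold (interval_atlas B)"
proof -
  have "homeomorphism B B (\<lambda>r. r) (param (interval_atlas B) i)" for i
    by (rule homeomorphism_cong[OF homeomorphism_ident]) auto
  moreover have "smooth_on B (transition (interval_atlas B) i j)" for i j
    by (subst smooth_on_cong[OF assms(1), of _ "\<lambda>r. r"])
      (auto simp: transition_def intro!: smooth_on_bounded_linear assms(1) bounded_linear_ident)
  ultimately show ?thesis
    using assms by (simp add: connected_manifold_def is_interval_connected)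
qed

lemma frechet_derivative_transition_interval_atlas:
  assumes "open B" "r \<in> B"
  shows "frechet_derivative (transition (interval_atlas B) i j) (at r) = (\<lambda>t. t)"
proof -
  have "frechet_derivative (transition (interval_atlas B) i j) (at r) =
      frechet_derivative (\<lambda>r. r) (at r)"
    by (rule frechet_derivative_cong_open[OF assms]) (simp add: transition_def)
  then show ?thesis by simp
qed

lemma pseudo_riemannian_interval_metric:
  assumes "open B" "\<epsilon> \<noteq> 0"
  shows "pseudo_riemannian_metric (interval_atlas B) (interval_metric \<epsilon>)"
  unfolding pseudo_riemannian_metric_def interval_metric_def interval_atlas_simps
proof (intro conjI ballI allI impI)
  show "bilinear (\<lambda>a. (*) (\<epsilon> * a))"
    by (auto simp: bilinear_def algebra_simps intro!: linearI)
  show "u = 0" if "\<forall>w. \<epsilon> * u * w = 0" for u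
    using that[rule_format, of 1] assms(2) by simp
qed (simp_all add: smooth_on_const frechet_derivative_transition_interval_atlas assms(1))

lemma smooth_function_interval_atlas:
  assumes "open B" "smooth_on B h"
  shows "smooth_function (interval_atlas B) h"
  unfolding smooth_function_def interval_atlas_simps
  by (intro ballI iffD2[OF smooth_on_cong[OF assms(1)] assms(2)]) simp

subsection \<open>The Einstein condition as a pair of scalar equations\<close>

lemma metric_chart_of_metric:
  assumes "connected_manifold A" "pseudo_riemannian_metric A g" "i \<in> index A"
  shows "metric_chart (coords A i) (g i)"
  using assms manifold_open_coords[OF assms(1,3)]
  unfolding pseudo_riemannian_metric_def by unfold_locales blast+

lemma einstein_withD:
  assumes "einstein_with A g lam"
  shows "connected_manifold A" "pseudo_riemannian_metric A g" "smooth_function A lam"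
    and "i \<in> index A \<Longrightarrow> x \<in> coords A i \<Longrightarrow> ricci (g i) x u w = lam (param A i x) * g i x u w"
  using assms by (auto simp: einstein_with_def)

section \<open>Scalar data of the warping function\<close>

locale interval_warping =
  fixes B :: "real set" and \<epsilon> \<mu> :: real and \<psi> :: "real \<Rightarrow> real"
  assumes open_B: "open B"
    and \<epsilon>: "\<epsilon> \<in> {1, -1}"
    and smooth: "smooth_on B \<psi>"
    and pos: "r \<in> B \<Longrightarrow> \<psi> r > 0"
begin

definition W :: "real \<Rightarrow> real" where "W r = \<psi> r powr (- 2 * \<mu>)"
text \<open>Since \<epsilon> \<open>W\<close> is the inverse of the base coefficient,
  \<open>X\<close> is the squared gradient of \<psi> for the base metric, and
  \<open>Y - \<mu> X\<close> is \<psi> times its Laplacian. The two Einstein equations are thus the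
  base and fibre parts of the usual warped product formula.\<close>

definition X :: "real \<Rightarrow> real" where "X r = \<epsilon> * W r * (deriv \<psi> r)\<^sup>2"
definition Y :: "real \<Rightarrow> real" where "Y r = \<epsilon> * W r * (\<psi> r * deriv (deriv \<psi>) r)"

text \<open>Here \<open>l\<close> is a single number, because the Einstein function may a priori
  depend on the fibre point as well as on \<open>r\<close>.\<close>

definition einstein_at :: "nat \<Rightarrow> real \<Rightarrow> real \<Rightarrow> real \<Rightarrow> bool" where
  "einstein_at k \<nu> l r \<longleftrightarrow> l * (\<psi> r)\<^sup>2 = k * (\<mu> * X r - Y r) \<and>
     l * (\<psi> r)\<^sup>2 = \<nu> - (real k - 1 - \<mu>) * X r - Y r"

lemma \<epsilon>_square [simp]: "\<epsilon> * \<epsilon> = 1" "\<epsilon> * (\<epsilon> * x) = x"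
  using \<epsilon> by auto

lemmas \<psi>_deriv = smooth_on_has_real_derivative[OF open_B smooth]
lemmas \<psi>'_deriv = smooth_on_has_real_derivative[OF open_B smooth_on_deriv[OF open_B smooth]]
lemmas \<psi>''_deriv = smooth_on_has_real_derivative[OF open_B
    smooth_on_deriv[OF open_B smooth_on_deriv[OF open_B smooth]]]

lemma powr_deriv:
  assumes "r \<in> B"
  shows "((\<lambda>r. \<psi> r powr c) has_real_derivative c * \<psi> r powr (c - 1) * deriv \<psi> r) (at r)"
  by (rule DERIV_chain2[where f = "\<lambda>x. x powr c", OF has_real_derivative_powr[OF pos[OF assms]]
        \<psi>_deriv[OF assms]])

lemma W_pos: "r \<in> B \<Longrightarrow> W r > 0"
  using pos[of r] by (simp add: W_def)

lemma powr_2\<mu>: "r \<in> B \<Longrightarrow> \<psi> r powr (2 * \<mu>) * W r = 1"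
  using pos[of r] by (simp add: W_def powr_minus)

lemma W_deriv:
  assumes "r \<in> B"
  shows "(W has_real_derivative - 2 * \<mu> * W r / \<psi> r * deriv \<psi> r) (at r)"
proof -
  have "\<psi> r powr (- 2 * \<mu> - 1) = W r / \<psi> r"
    using pos[OF assms] by (simp add: W_def powr_diff)
  then show ?thesis
    using powr_deriv[OF assms, of "- 2 * \<mu>"] by (simp add: W_def[abs_def])
qed

text \<open>For a = \<epsilon> \<psi>^(2\<mu>) and b = \<psi>^2 the logarithmic derivatives give p =
  \<mu> s with s = \<psi>'/\<psi>, and dividing b' by 2a gives q = \<epsilon> W \<psi> \<psi>'. The
  derivative of q is already a combination of \<open>X\<close> and \<open>Y\<close>.\<close>

lemma warped_chart:
  assumes "metric_chart U g"
    and "\<And>r y \<alpha> u \<beta> w. r \<in> B \<Longrightarrow> y \<in> U \<Longrightarrow>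
      G (r, y) (\<alpha>, u) (\<beta>, w) = \<epsilon> * \<psi> r powr (2 * \<mu>) * (\<alpha> * \<beta>) + (\<psi> r)\<^sup>2 * g y u w"
  shows "warped_chart U g B (\<lambda>r. \<epsilon> * \<psi> r powr (2 * \<mu>)) (\<lambda>r. (\<psi> r)\<^sup>2)
    (\<lambda>r. \<epsilon> * (2 * \<mu> * \<psi> r powr (2 * \<mu> - 1) * deriv \<psi> r)) (\<lambda>r. 2 * \<psi> r * deriv \<psi> r)
    (\<lambda>r. \<mu> * (deriv \<psi> r / \<psi> r)) (\<lambda>r. \<epsilon> * W r * (\<psi> r * deriv \<psi> r)) (\<lambda>r. deriv \<psi> r / \<psi> r)
    (\<lambda>r. \<mu> * ((deriv (deriv \<psi>) r * \<psi> r - (deriv \<psi> r)\<^sup>2) / (\<psi> r)\<^sup>2))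
    (\<lambda>r. (1 - 2 * \<mu>) * X r + Y r)
    (\<lambda>r. (deriv (deriv \<psi>) r * \<psi> r - (deriv \<psi> r)\<^sup>2) / (\<psi> r)\<^sup>2) G"
proof -
  interpret metric_chart U g by fact
  show ?thesis
  proof
    fix r assume r: "r \<in> B"
    note [simp] = less_imp_neq[OF pos[OF r], symmetric]
    note \<psi>_deriv[OF r, derivative_intros] \<psi>'_deriv[OF r, derivative_intros]
      W_deriv[OF r, derivative_intros] powr_deriv[OF r, derivative_intros]
    show "\<epsilon> * \<psi> r powr (2 * \<mu>) \<noteq> 0" "(\<psi> r)\<^sup>2 \<noteq> 0" using \<epsilon> by auto
    show "((\<lambda>r. \<epsilon> * \<psi> r powr (2 * \<mu>)) has_real_derivative
        \<epsilon> * (2 * \<mu> * \<psi> r powr (2 * \<mu> - 1) * deriv \<psi> r)) (at r)"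
      by (rule DERIV_cmult[OF powr_deriv[OF r]])
    show "((\<lambda>r. (\<psi> r)\<^sup>2) has_real_derivative 2 * \<psi> r * deriv \<psi> r) (at r)"
      by (auto intro!: derivative_eq_intros)
    have s: "((\<lambda>r. deriv \<psi> r / \<psi> r) has_real_derivative
        (deriv (deriv \<psi>) r * \<psi> r - (deriv \<psi> r)\<^sup>2) / (\<psi> r)\<^sup>2) (at r)"
      by (auto intro!: derivative_eq_intros simp: power2_eq_square)
    then show "((\<lambda>r. deriv \<psi> r / \<psi> r) has_real_derivative
        (deriv (deriv \<psi>) r * \<psi> r - (deriv \<psi> r)\<^sup>2) / (\<psi> r)\<^sup>2) (at r)" .
    show "((\<lambda>r. \<mu> * (deriv \<psi> r / \<psi> r)) has_real_derivative
        \<mu> * ((deriv (deriv \<psi>) r * \<psi> r - (deriv \<psi> r)\<^sup>2) / (\<psi> r)\<^sup>2)) (at r)"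
      by (rule DERIV_cmult[OF s])
    show "((\<lambda>r. \<epsilon> * W r * (\<psi> r * deriv \<psi> r)) has_real_derivative
        (1 - 2 * \<mu>) * X r + Y r) (at r)"
      by (auto intro!: derivative_eq_intros simp: X_def Y_def field_simps power2_eq_square)
    have "\<psi> r powr (2 * \<mu> - 1) = \<psi> r powr (2 * \<mu>) / \<psi> r"
      using pos[OF r] by (simp add: powr_diff)
    then show "2 * (\<epsilon> * \<psi> r powr (2 * \<mu>)) * (\<mu> * (deriv \<psi> r / \<psi> r)) =
        \<epsilon> * (2 * \<mu> * \<psi> r powr (2 * \<mu> - 1) * deriv \<psi> r)"
      by simp
    have "2 * (\<epsilon> * \<psi> r powr (2 * \<mu>)) * (\<epsilon> * W r * (\<psi> r * deriv \<psi> r)) =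
        (\<epsilon> * \<epsilon>) * (\<psi> r powr (2 * \<mu>) * W r) * (2 * \<psi> r * deriv \<psi> r)"
      by (simp only: mult_ac)
    then show "2 * (\<epsilon> * \<psi> r powr (2 * \<mu>)) * (\<epsilon> * W r * (\<psi> r * deriv \<psi> r)) =
        2 * \<psi> r * deriv \<psi> r"
      by (simp only: powr_2\<mu>[OF r] \<epsilon>_square mult_1)
    show "2 * (\<psi> r)\<^sup>2 * (deriv \<psi> r / \<psi> r) = 2 * \<psi> r * deriv \<psi> r"
      by (simp add: power2_eq_square)
  qed (use open_B assms(2) in auto)
qed

lemma ricci_warped:
  fixes U :: "'e::euclidean_space set"
  assumes "metric_chart U g"
    and "\<And>r y \<alpha> u \<beta> w. r \<in> B \<Longrightarrow> y \<in> U \<Longrightarrow>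
      G (r, y) (\<alpha>, u) (\<beta>, w) = \<epsilon> * \<psi> r powr (2 * \<mu>) * (\<alpha> * \<beta>) + (\<psi> r)\<^sup>2 * g y u w"
    and r: "r \<in> B" and y: "y \<in> U"
  shows "ricci G (r, y) (\<beta>, w) (\<gamma>, t) = ricci g y w t
    + DIM('e) * (\<mu> * X r - Y r) / (\<psi> r)\<^sup>2 * (\<epsilon> * \<psi> r powr (2 * \<mu>) * (\<beta> * \<gamma>))
    - ((DIM('e) - 1 - \<mu>) * X r + Y r) * g y w t"
proof -
  have nz: "\<psi> r \<noteq> 0" using pos[OF r] by simp
  have "\<mu> * X r - Y r = \<epsilon> * W r * (\<mu> * (deriv \<psi> r)\<^sup>2 - \<psi> r * deriv (deriv \<psi>) r)"
    by (simp add: X_def Y_def algebra_simps)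
  then have "(\<mu> * X r - Y r) * (\<epsilon> * \<psi> r powr (2 * \<mu>)) =
      (\<epsilon> * \<epsilon>) * (\<psi> r powr (2 * \<mu>) * W r) * (\<mu> * (deriv \<psi> r)\<^sup>2 - \<psi> r * deriv (deriv \<psi>) r)"
    by (simp only: mult_ac)
  then have XY: "(\<mu> * X r - Y r) * (\<epsilon> * \<psi> r powr (2 * \<mu>)) =
      \<mu> * (deriv \<psi> r)\<^sup>2 - \<psi> r * deriv (deriv \<psi>) r"
    by (simp only: powr_2\<mu>[OF r] \<epsilon>_square mult_1)
  \<comment> \<open>The base coefficient is split off, so that the base block of the Ricci tensor
    appears as a multiple of the base block of the metric.\<close>
  have 1: "deriv \<psi> r / \<psi> r * (\<mu> * (deriv \<psi> r / \<psi> r))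
      - (deriv (deriv \<psi>) r * \<psi> r - (deriv \<psi> r)\<^sup>2) / (\<psi> r)\<^sup>2 - (deriv \<psi> r / \<psi> r)\<^sup>2
      = (\<mu> * X r - Y r) / (\<psi> r)\<^sup>2 * (\<epsilon> * \<psi> r powr (2 * \<mu>))"
    unfolding times_divide_eq_left XY using nz by (simp add: field_simps power2_eq_square)
  have 2: "- ((1 - 2 * \<mu>) * X r + Y r) - \<mu> * (deriv \<psi> r / \<psi> r) * (\<epsilon> * W r * (\<psi> r * deriv \<psi> r))
      + (2 - real DIM('e)) * (\<epsilon> * W r * (\<psi> r * deriv \<psi> r) * (deriv \<psi> r / \<psi> r))
      = - ((DIM('e) - 1 - \<mu>) * X r + Y r)"
    using nz by (simp add: X_def field_simps power2_eq_square)
  interpret warped_chart U g B "\<lambda>r. \<epsilon> * \<psi> r powr (2 * \<mu>)" "\<lambda>r. (\<psi> r)\<^sup>2"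
    "\<lambda>r. \<epsilon> * (2 * \<mu> * \<psi> r powr (2 * \<mu> - 1) * deriv \<psi> r)" "\<lambda>r. 2 * \<psi> r * deriv \<psi> r"
    "\<lambda>r. \<mu> * (deriv \<psi> r / \<psi> r)" "\<lambda>r. \<epsilon> * W r * (\<psi> r * deriv \<psi> r)" "\<lambda>r. deriv \<psi> r / \<psi> r"
    "\<lambda>r. \<mu> * ((deriv (deriv \<psi>) r * \<psi> r - (deriv \<psi> r)\<^sup>2) / (\<psi> r)\<^sup>2)"
    "\<lambda>r. (1 - 2 * \<mu>) * X r + Y r"
    "\<lambda>r. (deriv (deriv \<psi>) r * \<psi> r - (deriv \<psi> r)\<^sup>2) / (\<psi> r)\<^sup>2" G
    using assms(1,2) by (rule warped_chart)
  show ?thesis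
    unfolding ricci_G[OF r y] 1 2 by (simp add: algebra_simps)
qed

text \<open>The Einstein equation of the fibre turns its Ricci tensor into \<nu> times its metric,
  leaving two coefficients to compare. Smoothness of \<open>lam\<close> stays on the right because
  \<open>einstein_with\<close> includes it.\<close>

lemma einstein_with_warped_iff:
  fixes F :: "('i, 'a::{second_countable_topology, t2_space}, 'e::euclidean_space) atlas"
  assumes B: "is_interval B" "B \<noteq> {}" and F: "einstein_with F g\<^sub>F (\<lambda>_. \<nu>)"
  shows "einstein_with (product_atlas (interval_atlas B) F)
      (weighted_product_metric (interval_atlas B) F (\<lambda>(r, _). \<psi> r powr (2 * \<mu>))
        (interval_metric \<epsilon>) (\<lambda>(r, _). (\<psi> r)\<^sup>2) g\<^sub>F) lam \<longleftrightarrow>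
    smooth_function (product_atlas (interval_atlas B) F) lam \<and>
    (\<forall>r\<in>B. \<forall>p\<in>carrier F. einstein_at DIM('e) \<nu> (lam (r, p)) r)"
    (is "einstein_with ?M ?g lam \<longleftrightarrow> _")
proof -
  note F_mfd = einstein_withD(1)[OF F] and F_metric = einstein_withD(2)[OF F]
  note B_mfd = connected_manifold_interval_atlas[OF open_B B]
  have M: "connected_manifold ?M"
    using B_mfd F_mfd by (rule connected_manifold_product_atlas)
  have "smooth_function ?M (\<lambda>(r, _). \<psi> r powr (2 * \<mu>))" "smooth_function ?M (\<lambda>(r, _). (\<psi> r)\<^sup>2)"
    using smooth_on_powr[OF open_B smooth pos] smooth_on_mult[OF open_B smooth smooth]
    by (auto intro!: smooth_function_fst B_mfd F_mfd smooth_function_interval_atlas open_B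
        simp: power2_eq_square)
  then have metric: "pseudo_riemannian_metric ?M ?g"
    using pos \<epsilon> open_B
    by (intro pseudo_riemannian_weighted_product_metric B_mfd F_mfd F_metric
        pseudo_riemannian_interval_metric) (auto simp: less_imp_neq[symmetric])
  have g: "?g (j, i) (r, y) (\<alpha>, u) (\<beta>, w) =
      \<epsilon> * \<psi> r powr (2 * \<mu>) * (\<alpha> * \<beta>) + (\<psi> r)\<^sup>2 * g\<^sub>F i y u w"
    if "r \<in> B" for i j r y \<alpha> u \<beta> w
    using that by (simp add: weighted_product_metric_def interval_metric_def)
  have "(\<forall>z w. ricci (?g (j, i)) (r, y) z w = l * ?g (j, i) (r, y) z w) \<longleftrightarrow>
      einstein_at DIM('e) \<nu> l r"
    if r: "r \<in> B" and i: "i \<in> index F" and y: "y \<in> coords F i" for r i j y l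
  proof -
    interpret F: metric_chart "coords F i" "g\<^sub>F i"
      using F_mfd F_metric i by (rule metric_chart_of_metric)
    define c1 where "c1 = DIM('e) * (\<mu> * X r - Y r) / (\<psi> r)\<^sup>2"
    define c2 where "c2 = \<nu> - (real DIM('e) - 1 - \<mu>) * X r - Y r"
    define e where "e = \<epsilon> * \<psi> r powr (2 * \<mu>)"
    have ricci: "ricci (?g (j, i)) (r, y) (\<beta>, w) (\<gamma>, t) = c1 * (e * (\<beta> * \<gamma>)) + c2 * g\<^sub>F i y w t"
      for \<beta> w \<gamma> t
      using ricci_warped[where G = "?g (j, i)", OF F.metric_chart_axioms g r y] einstein_withD(4)[OF F i y]
      by (simp add: c1_def c2_def e_def algebra_simps)
    have "(\<forall>z w. ricci (?g (j, i)) (r, y) z w = l * ?g (j, i) (r, y) z w) \<longleftrightarrow>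
        (\<forall>\<beta> w \<gamma> t. c1 * (e * (\<beta> * \<gamma>)) + c2 * g\<^sub>F i y w t =
          l * (e * (\<beta> * \<gamma>) + (\<psi> r)\<^sup>2 * g\<^sub>F i y w t))"
      by (simp only: split_paired_All ricci g[OF r] e_def)
    \<comment> \<open>Two base vectors isolate \<open>c1\<close>; a pair of fibre vectors with
      nonzero product, which nondegeneracy supplies, then isolates \<open>c2\<close>.\<close>
    also have "\<dots> \<longleftrightarrow> c1 = l \<and> c2 = l * (\<psi> r)\<^sup>2"
    proof
      assume *: "\<forall>\<beta> w \<gamma> t. c1 * (e * (\<beta> * \<gamma>)) + c2 * g\<^sub>F i y w t =
          l * (e * (\<beta> * \<gamma>) + (\<psi> r)\<^sup>2 * g\<^sub>F i y w t)"
      have "e \<noteq> 0" using pos[OF r] \<epsilon> by (auto simp: e_def)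
      then have "c1 = l"
        using *[rule_format, of 1 1 0 0] by (simp add: bilinear_rzero[OF F.bilinear[OF y]])
      obtain b :: 'e where "b \<noteq> 0" using nonempty_Basis nonzero_Basis by blast
      then obtain w where "g\<^sub>F i y b w \<noteq> 0" using F.nondegenerate[OF y] by blast
      with \<open>c1 = l\<close> show "c1 = l \<and> c2 = l * (\<psi> r)\<^sup>2" using *[rule_format, of 0 0 b w] by simp
    qed (simp add: algebra_simps)
    also have "\<dots> \<longleftrightarrow> einstein_at DIM('e) \<nu> l r"
      using pos[OF r] by (auto simp: c1_def c2_def einstein_at_def field_simps)
    finally show ?thesis .
  qed
  then have "(\<forall>c\<in>index ?M. \<forall>z\<in>coords ?M c. \<forall>u w.
        ricci (?g c) z u w = lam (param ?M c z) * ?g c z u w) \<longleftrightarrow>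
      (\<forall>i\<in>index F. \<forall>r\<in>B. \<forall>y\<in>coords F i. einstein_at DIM('e) \<nu> (lam (r, param F i y)) r)"
    by (auto simp: param_product_atlas[OF B_mfd F_mfd])
  also have "\<dots> \<longleftrightarrow> (\<forall>r\<in>B. \<forall>p\<in>carrier F. einstein_at DIM('e) \<nu> (lam (r, p)) r)"
    using param_in_carrier[OF F_mfd] carrierE[OF F_mfd] by metis
  finally show ?thesis
    using M metric by (simp add: einstein_with_def)
qed

end

subsection \<open>Reduction to the first integral\<close>

context interval_warping
begin

text \<open>The combination \<open>Y - \<mu> X\<close> of the first Einstein equation reappears
  here; this makes the derivative of the first integral proportional to that equation.\<close>

lemma X_deriv:
  assumes "r \<in> B"
  shows "(X has_real_derivative 2 * (deriv \<psi> r / \<psi> r) * (Y r - \<mu> * X r)) (at r)"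
proof -
  have [simp]: "\<psi> r \<noteq> 0" using pos[OF assms] by simp
  note \<psi>'_deriv[OF assms, derivative_intros] W_deriv[OF assms, derivative_intros]
  show ?thesis
    unfolding X_def[abs_def]
    by (auto intro!: derivative_eq_intros simp: X_def Y_def field_simps power2_eq_square)
qed

lemma first_integral_of_einstein_at:
  assumes "einstein_at k \<nu> l r" "k \<ge> 2"
  shows "(real k - 1) * (X r + l / real k * (\<psi> r)\<^sup>2) = \<nu>"
proof -
  have l: "l / real k * (\<psi> r)\<^sup>2 = \<mu> * X r - Y r"
    using assms by (simp add: einstein_at_def field_simps)
  have "\<nu> = real k * (\<mu> * X r - Y r) + (real k - 1 - \<mu>) * X r + Y r"
    using assms(1) by (simp add: einstein_at_def)
  then show ?thesis unfolding l by (simp add: algebra_simps)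
qed

lemma einstein_atI:
  assumes "(real k - 1) * (X r + l / real k * (\<psi> r)\<^sup>2) = \<nu>"
    and "l * (\<psi> r)\<^sup>2 = real k * (\<mu> * X r - Y r)" "k \<ge> 2"
  shows "einstein_at k \<nu> l r"
proof -
  have "l / real k * (\<psi> r)\<^sup>2 = \<mu> * X r - Y r"
    using assms(2,3) by (simp add: field_simps)
  with assms(1) have "\<nu> = (real k - 1) * (X r + (\<mu> * X r - Y r))" by simp
  with assms(2) show ?thesis by (simp add: einstein_at_def algebra_simps)
qed

text \<open>Nothing is assumed about regularity of \<open>l\<close>: for \<open>k \<ge> 2\<close>
  the first integral can be solved for \<open>l\<close>, and the resulting expression
  \<open>h\<close> is differentiable.\<close>

lemma einstein_at_imp_constant:
  assumes "is_interval B" "k \<ge> 2" and E: "\<And>r. r \<in> B \<Longrightarrow> einstein_at k \<nu> (l r) r"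
  shows "\<exists>c. \<forall>r\<in>B. l r = c"
proof (rule has_field_derivative_zero_constant)
  show "convex B" using assms(1) by (rule is_interval_convex)
  fix r assume r: "r \<in> B"
  define h where "h r = k * (\<nu> / (real k - 1) - X r) / (\<psi> r)\<^sup>2" for r
  have l: "l r = h r" if "r \<in> B" for r
    using first_integral_of_einstein_at[OF E[OF that] assms(2)] pos[OF that] assms(2)
    by (simp add: h_def field_simps)
  have nz [simp]: "\<psi> r \<noteq> 0" using pos[OF r] by simp
  note X_deriv[OF r, derivative_intros] \<psi>_deriv[OF r, derivative_intros]
  have "\<mu> * X r - Y r = l r * (\<psi> r)\<^sup>2 / real k" "\<nu> / (real k - 1) - X r = l r * (\<psi> r)\<^sup>2 / real k"
    using E[OF r] first_integral_of_einstein_at[OF E[OF r] assms(2)] assms(2)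
    by (auto simp: einstein_at_def field_simps)
  then have XY: "X r * \<mu> = l r * (\<psi> r)\<^sup>2 / real k + Y r"
      "\<nu> / (real k - 1) = l r * (\<psi> r)\<^sup>2 / real k + X r"
    by (simp_all add: algebra_simps)
  have "(h has_real_derivative
      (k * - (2 * (deriv \<psi> r / \<psi> r) * (Y r - \<mu> * X r)) * (\<psi> r)\<^sup>2
        - k * (\<nu> / (real k - 1) - X r) * (2 * \<psi> r * deriv \<psi> r)) / ((\<psi> r)\<^sup>2 * (\<psi> r)\<^sup>2)) (at r)"
    unfolding h_def[abs_def] by (auto intro!: derivative_eq_intros)
  \<comment> \<open>Both Einstein relations express their brackets as
    \<open>l r * (\<psi> r)\<^sup>2 / k\<close>, so the two summands are opposite.\<close>
  moreover have "k * - (2 * (deriv \<psi> r / \<psi> r) * (Y r - \<mu> * X r)) * (\<psi> r)\<^sup>2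
        - k * (\<nu> / (real k - 1) - X r) * (2 * \<psi> r * deriv \<psi> r) = 0"
    unfolding XY(2) mult.commute[of \<mu>] XY(1) using assms(2)
    by (simp add: field_simps power2_eq_square)
  ultimately have "(h has_real_derivative 0) (at r)" by simp
  then have "(l has_real_derivative 0) (at r)"
    by (rule has_field_derivative_transform_within_open[OF _ open_B r]) (simp add: l)
  then show "(l has_real_derivative 0) (at r within B)" by (rule has_field_derivative_at_within)
qed

text \<open>Differentiating the first integral gives \<open>\<psi>' H = 0\<close>. Where \<open>H\<close> does not vanish, \<open>\<psi>'\<close> and
  \<open>\<psi>''\<close> do, and there \<open>H\<close> reduces to \<open>c \<psi>\<^sup>2 / k\<close>; so \<open>B\<close> is the disjoint union of the closed sets
  \<open>{H = 0}\<close> and \<open>{\<psi>' = \<psi>'' = 0}\<close> unless \<open>c = 0\<close>.\<close>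

lemma first_integral_imp_einstein_at:
  assumes "is_interval B" "k \<ge> 2" "\<not> \<psi> constant_on B"
    and I: "\<And>r. r \<in> B \<Longrightarrow> (real k - 1) * (X r + c / real k * (\<psi> r)\<^sup>2) = \<nu>"
    and "r \<in> B"
  shows "einstein_at k \<nu> c r"
proof (rule einstein_atI[OF I[OF \<open>r \<in> B\<close>] _ assms(2)])
  define H where "H r = c / real k * (\<psi> r)\<^sup>2 - (\<mu> * X r - Y r)" for r
  have \<psi>'H: "deriv \<psi> r * H r = 0" if r: "r \<in> B" for r
  proof -
    have nz [simp]: "\<psi> r \<noteq> 0" using pos[OF r] by simp
    note X_deriv[OF r, derivative_intros] \<psi>_deriv[OF r, derivative_intros]
    \<comment> \<open>The variable \<open>d\<close> stands for \<open>c / real k\<close>, so that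
      \<open>field_simps\<close> does not clear that denominator.\<close>
    have "((\<lambda>r. (real k - 1) * (X r + d * (\<psi> r)\<^sup>2)) has_real_derivative
        (real k - 1) * (2 * (deriv \<psi> r / \<psi> r) * (d * (\<psi> r)\<^sup>2 - (\<mu> * X r - Y r)))) (at r)" for d
      by (auto intro!: derivative_eq_intros simp: field_simps power2_eq_square)
    then have "((\<lambda>r. (real k - 1) * (X r + c / real k * (\<psi> r)\<^sup>2)) has_real_derivative
        (real k - 1) * (2 * (deriv \<psi> r / \<psi> r) * H r)) (at r)"
      unfolding H_def .
    moreover have "((\<lambda>r. (real k - 1) * (X r + c / real k * (\<psi> r)\<^sup>2)) has_real_derivative 0) (at r)"
      by (rule has_field_derivative_transform_within_open[OF DERIV_const[of \<nu>] open_B r])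
        (rule I[symmetric])
    ultimately have "(real k - 1) * (2 * (deriv \<psi> r / \<psi> r) * H r) = 0" by (rule DERIV_unique)
    with assms(2) show ?thesis by simp
  qed
  have cont: "continuous_on B \<psi>" "continuous_on B (deriv \<psi>)" "continuous_on B (deriv (deriv \<psi>))"
    using \<psi>_deriv \<psi>'_deriv \<psi>''_deriv
    by (auto intro!: continuous_at_imp_continuous_on DERIV_isCont)
  have cont_W: "continuous_on B W"
    using W_deriv by (auto intro!: continuous_at_imp_continuous_on DERIV_isCont)
  have cont_H: "continuous_on B H"
    unfolding H_def[abs_def] X_def[abs_def] Y_def[abs_def]
    by (intro continuous_intros cont cont_W)
  have dichotomy: "H r = 0 \<or> deriv \<psi> r = 0 \<and> deriv (deriv \<psi>) r = 0" if "r \<in> B" for r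
  proof (cases "H r = 0")
    case False
    \<comment> \<open>Continuity of \<open>H\<close> makes \<psi>' vanish on a whole neighbourhood,
      which is what forces \<psi>'' to vanish at the point too.\<close>
    define N where "N = B \<inter> H -` (- {0})"
    have "open N" unfolding N_def
      by (rule continuous_open_preimage[OF cont_H open_B]) auto
    moreover have "r \<in> N" using that False by (simp add: N_def)
    moreover have \<psi>': "deriv \<psi> r = 0" if "r \<in> N" for r using \<psi>'H[of r] that by (simp add: N_def)
    ultimately have "(deriv \<psi> has_real_derivative 0) (at r)"
      by (intro has_field_derivative_transform_within_open[OF DERIV_const[of 0]]) auto
    then show ?thesis using \<psi>'[OF \<open>r \<in> N\<close>] by (simp add: DERIV_imp_deriv)
  qed simp
  have flat: "H r = c / real k * (\<psi> r)\<^sup>2" if "deriv \<psi> r = 0" "deriv (deriv \<psi>) r = 0" for r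
    using that by (simp add: H_def X_def Y_def)
  have "H r = 0"
  proof (cases "c = 0")
    \<comment> \<open>The two closed sets need not be disjoint in this case, but \<open>flat\<close>
      gives \<open>H r = 0\<close> on both.\<close>
    case True
    then show ?thesis using dichotomy[OF \<open>r \<in> B\<close>] flat[of r] by auto
  next
    case False
    let ?S = "{r \<in> B. H r = 0}"
      and ?T = "{r \<in> B. deriv \<psi> r = 0} \<inter> {r \<in> B. deriv (deriv \<psi>) r = 0}"
    have "closedin (top_of_set B) ?S" "closedin (top_of_set B) ?T"
      by (intro closedin_Int continuous_closedin_preimage_constant cont cont_H)+
    moreover have "B \<subseteq> ?S \<union> ?T" using dichotomy by auto
    moreover have "?S \<inter> ?T = {}"
      using flat pos False assms(2) by (force dest: less_imp_neq)
    moreover have "connected B" using assms(1) by (rule is_interval_connected)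
    ultimately have "?S = {} \<or> ?T = {}" by (metis (no_types, lifting) connected_closedin)
    \<comment> \<open>If \<open>H\<close> vanished nowhere, \<psi>' would be zero on the whole
      interval, against nonconstancy; so \<open>?T\<close> is the empty set of the two.\<close>
    moreover have "?S \<noteq> {}"
    proof
      assume "?S = {}"
      then have "deriv \<psi> r = 0" if "r \<in> B" for r using dichotomy that by blast
      then have "(\<psi> has_real_derivative 0) (at r within B)" if "r \<in> B" for r
        using \<psi>_deriv[OF that] that by (simp add: has_field_derivative_at_within)
      then have "\<psi> constant_on B"
        using has_field_derivative_zero_constant[OF is_interval_convex[OF assms(1)]]
        by (auto simp: constant_on_def)
      with assms(3) show False by simp
    qed
    ultimately show ?thesis using dichotomy[OF \<open>r \<in> B\<close>] \<open>r \<in> B\<close> by blast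
  qed
  then show "c * (\<psi> r)\<^sup>2 = real k * (\<mu> * X r - Y r)"
    using assms(2) by (simp add: H_def field_simps)
qed

lemma einstein_at_constant_iff:
  assumes "\<psi> constant_on B" "r \<in> B"
  shows "einstein_at k \<nu> l r \<longleftrightarrow> l = 0 \<and> \<nu> = 0"
proof -
  obtain c where c: "\<And>r. r \<in> B \<Longrightarrow> \<psi> r = c" using assms(1) by (auto simp: constant_on_def)
  have \<psi>': "deriv \<psi> r = 0" if "r \<in> B" for r
    by (rule DERIV_imp_deriv,
        rule has_field_derivative_transform_within_open[OF DERIV_const[of c] open_B that])
      (simp add: c)
  have "deriv (deriv \<psi>) r = 0"
    by (rule DERIV_imp_deriv,
        rule has_field_derivative_transform_within_open[OF DERIV_const[of 0] open_B assms(2)])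
      (simp add: \<psi>')
  then show ?thesis
    using \<psi>'[OF assms(2)] pos[OF assms(2)] by (auto simp: einstein_at_def X_def Y_def)
qed

section \<open>The equations in terms of v\<close>

lemma v_deriv:
  assumes "r \<in> B"
  shows "deriv (\<lambda>r. \<psi> r powr (1 - \<mu>)) r = (1 - \<mu>) * \<psi> r powr (- \<mu>) * deriv \<psi> r"
  using DERIV_imp_deriv[OF powr_deriv[OF assms, of "1 - \<mu>"]] by simp

text \<open>The exponent 1 - \<mu> is the one for which v' is a constant multiple of \<psi>^(-\<mu>)
  \<psi>', so that its square carries the weight \<open>W\<close> of \<open>X\<close>.\<close>

lemma first_integral_v:
  assumes "r \<in> B" "\<mu> \<noteq> 1"
  shows "\<epsilon> / (1 - \<mu>)\<^sup>2 * (deriv (\<lambda>r. \<psi> r powr (1 - \<mu>)) r)\<^sup>2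
      + c / real k * (\<psi> r powr (1 - \<mu>)) powr (2 / (1 - \<mu>)) = X r + c / real k * (\<psi> r)\<^sup>2"
proof -
  have "(\<psi> r powr (- \<mu>))\<^sup>2 = W r"
    by (simp add: W_def power2_eq_square flip: powr_add)
  moreover have "(1 - \<mu>) * (2 / (1 - \<mu>)) = 2"
    using assms(2) nonzero_mult_div_cancel_left[of "1 - \<mu>" 2] by simp
  then have "(\<psi> r powr (1 - \<mu>)) powr (2 / (1 - \<mu>)) = (\<psi> r)\<^sup>2"
    unfolding powr_powr using pos[OF assms(1)] by simp
  ultimately show ?thesis
    using assms(2) by (simp add: v_deriv[OF assms(1)] X_def power_mult_distrib)
qed

text \<open>For \<open>k = 1\<close> and \<nu> = 0 both equations read
  \<open>l * (\<psi> r)\<^sup>2 = \<mu> * X r - Y r\<close>. The second derivative of v contains the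
  same combination of \<psi>'^2 and \<psi> \<psi>'', and the power of v on the left is the base
  coefficient, that is, \<open>1 / W r\<close>.\<close>

lemma einstein_at_1_iff:
  assumes "r \<in> B" "\<mu> \<noteq> 1"
  defines "v \<equiv> \<lambda>r. \<psi> r powr (1 - \<mu>)"
  shows "einstein_at 1 0 l r \<longleftrightarrow>
    l * v r powr (2 * \<mu> / (1 - \<mu>)) = \<epsilon> / (\<mu> - 1) * (deriv (deriv v) r / v r)"
proof -
  have nz [simp]: "\<psi> r \<noteq> 0" "\<psi> r > 0" "\<bar>\<psi> r\<bar> = \<psi> r" using pos[OF assms(1)] by auto
  note powr_deriv[OF assms(1), derivative_intros] \<psi>'_deriv[OF assms(1), derivative_intros]
  have "((\<lambda>r. (1 - \<mu>) * \<psi> r powr (- \<mu>) * deriv \<psi> r) has_real_derivative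
      (1 - \<mu>) * (- \<mu> * \<psi> r powr (- \<mu> - 1) * (deriv \<psi> r)\<^sup>2
        + \<psi> r powr (- \<mu>) * deriv (deriv \<psi>) r)) (at r)"
    by (auto intro!: derivative_eq_intros simp: power2_eq_square algebra_simps)
  then have "(deriv v has_real_derivative
      (1 - \<mu>) * (- \<mu> * \<psi> r powr (- \<mu> - 1) * (deriv \<psi> r)\<^sup>2
        + \<psi> r powr (- \<mu>) * deriv (deriv \<psi>) r)) (at r)"
    by (rule has_field_derivative_transform_within_open[OF _ open_B assms(1)])
      (simp add: v_def v_deriv)
  then have "deriv (deriv v) r = (1 - \<mu>) * (- \<mu> * \<psi> r powr (- \<mu> - 1) * (deriv \<psi> r)\<^sup>2
        + \<psi> r powr (- \<mu>) * deriv (deriv \<psi>) r)"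
    by (rule DERIV_imp_deriv)
  moreover have "\<psi> r powr (- \<mu> - 1) = v r / (\<psi> r)\<^sup>2" "\<psi> r powr (- \<mu>) = v r / \<psi> r"
    by (simp_all add: v_def powr_diff powr_minus power2_eq_square field_simps)
  ultimately have v'': "deriv (deriv v) r =
      v r * ((1 - \<mu>) * (\<psi> r * deriv (deriv \<psi>) r - \<mu> * (deriv \<psi> r)\<^sup>2) / (\<psi> r)\<^sup>2)"
    by (simp add: field_simps power2_eq_square)
  have "v r \<noteq> 0" by (simp add: v_def)
  then have rhs: "\<epsilon> / (\<mu> - 1) * (deriv (deriv v) r / v r) =
      \<epsilon> * (\<mu> * (deriv \<psi> r)\<^sup>2 - \<psi> r * deriv (deriv \<psi>) r) / (\<psi> r)\<^sup>2"
    unfolding v'' using assms(2) by (simp add: divide_simps) (simp add: algebra_simps)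
  have "v r powr (2 * \<mu> / (1 - \<mu>)) = \<psi> r powr (2 * \<mu>)"
    unfolding v_def powr_powr using assms(2) by simp
  also have "\<dots> = 1 / W r"
    using powr_2\<mu>[OF assms(1)] W_pos[OF assms(1)] by (simp add: field_simps)
  finally have v_powr: "v r powr (2 * \<mu> / (1 - \<mu>)) = 1 / W r" .
  show ?thesis
    unfolding rhs v_powr using W_pos[OF assms(1)]
    by (simp add: einstein_at_def X_def Y_def field_simps)
qed

end

text \<open>Curvature is antisymmetric in its first two arguments, so it vanishes when there is a
  single basis vector, whereas nondegeneracy keeps the metric nonzero on that vector.\<close>

lemma einstein_constant_dim_1:
  fixes F :: "('i, 'a::{second_countable_topology, t2_space}, 'e::euclidean_space) atlas"
  assumes "einstein_with F g (\<lambda>_. \<nu>)" "DIM('e) = 1"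
  shows "\<nu> = 0"
proof -
  note F = einstein_withD(1,2)[OF assms(1)]
  obtain p where "p \<in> carrier F" using F(1) by (auto simp: connected_manifold_def)
  then obtain i x where i: "i \<in> index F" and x: "x \<in> coords F i" by (rule carrierE[OF F(1)])
  interpret metric_chart "coords F i" "g i" using F i by (rule metric_chart_of_metric)
  obtain b :: 'e where b: "Basis = {b}" using assms(2) by (rule card_1_singletonE)
  have "ricci (g i) x b b = 0" by (simp add: ricci_def b curvature_def)
  then have "\<nu> * g i x b b = 0" using einstein_withD(4)[OF assms(1) i x] by simp
  moreover have "g i x b b \<noteq> 0"
  proof
    assume *: "g i x b b = 0"
    have "flat x b = 0" by (simp add: flat_def b *)
    then have "b = 0" by (rule flat_eq_0[OF x])
    then show False using b nonzero_Basis by blast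
  qed
  ultimately show ?thesis by simp
qed

text \<open>Functions on \<open>M\<close> are total on the type \<open>real \<times> 'a\<close>, so
  claims about the values of \<open>lam\<close> are restricted to \<open>carrier M\<close>.\<close>

theorem mainTheorem5:
  fixes B :: "real set" and \<epsilon> \<nu> \<mu> :: real and k :: nat
    and F :: "('i, 'a::{second_countable_topology, t2_space}, 'e::euclidean_space) atlas"
    and g\<^sub>F :: "('i, 'e) metric_field"
    and \<psi> v :: "real \<Rightarrow> real"
    and M :: "(unit \<times> 'i, real \<times> 'a, real \<times> 'e) atlas"
    and g\<^sub>M :: "(unit \<times> 'i, real \<times> 'e) metric_field"
    and ode :: "real \<Rightarrow> bool"
  assumes "open B" "is_interval B" "B \<noteq> {}"
    and "\<epsilon> \<in> {1, -1}"
    and "k = DIM('e)"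
    and "einstein_with F g\<^sub>F (\<lambda>_. \<nu>)"
    and "\<mu> \<notin> {0, 1, real k, real k - sqrt ((real k)\<^sup>2 - real k), real k + sqrt ((real k)\<^sup>2 - real k)}"
    and "smooth_on B \<psi>" "\<forall>r\<in>B. \<psi> r > 0"
    and v_def: "v = (\<lambda>r. \<psi> r powr (1 - \<mu>))"
    and M_def: "M = product_atlas (interval_atlas B) F"
    and g\<^sub>M_def: "g\<^sub>M = weighted_product_metric (interval_atlas B) F
           (\<lambda>(r, _). \<psi> r powr (2 * \<mu>)) (interval_metric \<epsilon>) (\<lambda>(r, _). (\<psi> r)\<^sup>2) g\<^sub>F"
    and ode_def: "ode = (\<lambda>c. \<forall>r\<in>B.
           (real k - 1) * (\<epsilon> / (1 - \<mu>)\<^sup>2 * (deriv v r)\<^sup>2 + c / real k * v r powr (2 / (1 - \<mu>))) = \<nu>)"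
  shows "(k \<ge> 2 \<longrightarrow>
            (\<forall>lam. einstein_with M g\<^sub>M lam \<longrightarrow> (\<exists>c. (\<forall>p\<in>carrier M. lam p = c) \<and> ode c)) \<and>
            (\<forall>c. \<not> v constant_on B \<and> ode c \<longrightarrow> einstein_with M g\<^sub>M (\<lambda>_. c)) \<and>
            (\<psi> constant_on B \<longrightarrow>
               (\<forall>lam. einstein_with M g\<^sub>M lam \<longleftrightarrow> (\<forall>p\<in>carrier M. lam p = 0) \<and> \<nu> = 0)))
       \<and> (k = 1 \<longrightarrow>
            \<nu> = 0 \<and>
            (\<forall>lam. smooth_on B lam \<longrightarrow>
               (einstein_with M g\<^sub>M (\<lambda>(r, _). lam r) \<longleftrightarrow>
                (\<forall>r\<in>B. lam r * v r powr (2 * \<mu> / (1 - \<mu>)) = \<epsilon> / (\<mu> - 1) * (deriv (deriv v) r / v r)))))"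
proof -
  interpret interval_warping B \<epsilon> \<mu> \<psi>
    using assms(1,4,8,9) by unfold_locales auto
  have \<mu>: "\<mu> \<noteq> 1" using assms(7) by simp
  have F_mfd: "connected_manifold F" using assms(6) by (rule einstein_withD)
  have B_mfd: "connected_manifold (interval_atlas B)"
    using assms(1-3) by (rule connected_manifold_interval_atlas)
  obtain p0 where p0: "p0 \<in> carrier F" using F_mfd by (auto simp: connected_manifold_def)
  obtain r0 where r0: "r0 \<in> B" using assms(3) by auto
  have carrier_M: "carrier M = B \<times> carrier F" by (simp add: M_def)
  have iff: "einstein_with M g\<^sub>M lam \<longleftrightarrow> smooth_function M lam \<and>
      (\<forall>r\<in>B. \<forall>p\<in>carrier F. einstein_at k \<nu> (lam (r, p)) r)" for lam
    unfolding M_def g\<^sub>M_def assms(5) using assms(2,3,6) by (rule einstein_with_warped_iff)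
  have smooth_fst: "smooth_function M (\<lambda>(r, _). h r)" if "smooth_on B h" for h
    unfolding M_def
    by (rule smooth_function_fst[OF B_mfd F_mfd smooth_function_interval_atlas[OF assms(1) that]])
  have ode: "ode c \<longleftrightarrow> (\<forall>r\<in>B. (real k - 1) * (X r + c / real k * (\<psi> r)\<^sup>2) = \<nu>)" for c
    by (simp only: ode_def v_def first_integral_v[OF _ \<mu>] cong: ball_cong)
  have "\<exists>c. (\<forall>p\<in>carrier M. lam p = c) \<and> ode c" if k: "k \<ge> 2" and E: "einstein_with M g\<^sub>M lam" for lam
  proof -
    have *: "\<exists>c. \<forall>r\<in>B. lam (r, p) = c" if "p \<in> carrier F" for p
      using E that by (intro einstein_at_imp_constant[OF assms(2) k]) (auto simp: iff)
    obtain c where c: "\<And>r. r \<in> B \<Longrightarrow> lam (r, p0) = c" using *[OF p0] by blast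
    \<comment> \<open>Over the same \<open>r\<close> both values satisfy an equation whose
      right-hand side does not involve the fibre point; positivity of \<psi> makes them
      equal.\<close>
    have "lam (r, p) = c" if "r \<in> B" "p \<in> carrier F" for r p
    proof -
      have "einstein_at k \<nu> (lam (r, p)) r" "einstein_at k \<nu> (lam (r, p0)) r"
        using E that p0 by (auto simp: iff)
      then have "lam (r, p) * (\<psi> r)\<^sup>2 = lam (r, p0) * (\<psi> r)\<^sup>2" by (simp add: einstein_at_def)
      then show ?thesis using pos[OF that(1)] c[OF that(1)] by simp
    qed
    moreover have "einstein_at k \<nu> c r" if "r \<in> B" for r
      using E p0 that unfolding iff c[OF that, symmetric] by blast
    then have "ode c"
      unfolding ode using first_integral_of_einstein_at[OF _ k] by blast
    ultimately show ?thesis by (auto simp: carrier_M)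
  qed
  moreover have "einstein_with M g\<^sub>M (\<lambda>_. c)" if k: "k \<ge> 2" and "\<not> v constant_on B" "ode c" for c
  proof -
    have "\<not> \<psi> constant_on B"
      using that(2) unfolding v_def constant_on_def by metis
    then have "einstein_at k \<nu> c r" if "r \<in> B" for r
      using first_integral_imp_einstein_at[OF assms(2) k _ _ that] \<open>ode c\<close> by (simp add: ode)
    then show ?thesis
      by (simp add: iff smooth_function_def comp_def smooth_on_const)
  qed
  moreover have "einstein_with M g\<^sub>M lam \<longleftrightarrow> (\<forall>p\<in>carrier M. lam p = 0) \<and> \<nu> = 0"
    if "\<psi> constant_on B" for lam
  proof -
    \<comment> \<open>In the reverse implication \<open>lam\<close> is known only on the carrier, so
      its smoothness is obtained chart by chart from agreement with the zero function.\<close>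
    have "smooth_function M lam" if *: "\<And>p. p \<in> carrier M \<Longrightarrow> lam p = 0"
      unfolding smooth_function_def
    proof
      fix i assume i: "i \<in> index M"
      have M: "connected_manifold M"
        unfolding M_def using B_mfd F_mfd by (rule connected_manifold_product_atlas)
      show "smooth_on (coords M i) (lam \<circ> param M i)"
        by (rule iffD2[OF smooth_on_cong[OF manifold_open_coords[OF M i]] smooth_on_const[of _ 0]])
          (simp add: * param_in_carrier[OF M i])
    qed
    then show ?thesis
      using r0 p0 einstein_at_constant_iff[OF that] by (auto simp: iff carrier_M)
  qed
  moreover have "\<nu> = 0" if "k = 1"
    using einstein_constant_dim_1[OF assms(6)] that assms(5) by simp
  moreover have "einstein_with M g\<^sub>M (\<lambda>(r, _). lam r) \<longleftrightarrow>
      (\<forall>r\<in>B. lam r * v r powr (2 * \<mu> / (1 - \<mu>)) = \<epsilon> / (\<mu> - 1) * (deriv (deriv v) r / v r))"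
    if "k = 1" "\<nu> = 0" "smooth_on B lam" for lam
    using smooth_fst[OF that(3)] p0 einstein_at_1_iff[OF _ \<mu>] that(1,2)
    by (auto simp: iff v_def)
  ultimately show ?thesis by blast
qed

end
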